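(* Let $R \subseteq \mathbb{Q}^k$ be a semilinear relation. Then the following are equivalent. (1) $R$ is preserved by the median operation. (2) $R$ can be defined by a conjunction of atomic formulas $S(x_i,x_j)$, where each $S \subseteq \mathbb{Q}^2$ is a binary relation with the property that for each $(u,v) \in \mathbb{Q}^2 \setminus S$ at least one of the following sets is contained in $\mathbb{Q}^2 \setminus S$: $U_1 = \{(u',v') \mid u' \geq u, v' \geq v\}$, $U_2 = \{(u',v') \mid u' \geq u, v' \leq v\}$, $U_3 = \{(u',v') \mid u' \leq u, v' \geq v\}$, $U_4 = \{(u',v') \mid u' \leq u, v' \leq v\}$, $U_5 = \{(u',v) \mid u' \in \mathbb{Q}\}$, $U_6 = \{(u,v') \mid v' \in \mathbb{Q}\}$. (3) $R$ can be defined by a bijunctive formula.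
   Context: A relation $R \subseteq \mathbb{Q}^k$ is semilinear if it is definable by a first-order formula over $(\mathbb{Q};+,1,\leq)$ (equivalently, it is a Boolean combination of closed linear half-spaces). The median operation $\mathrm{median}\colon \mathbb{Q}^3 \to \mathbb{Q}$ maps $(x,y,z)$ to the middle element $v$ where $\{u,v,w\}=\{x,y,z\}$ and $u \le v \le w$. An operation $f\colon D^3\to D$ preserves $R \subseteq D^k$ if applying $f$ componentwise to any three tuples of $R$ yields a tuple of $R$. A bound on a variable $x$ is a formula $x \circ d$ with $\circ \in \{\leq,<,\geq,>\}$ and $d \in \mathbb{Q}\cup\{-\infty,+\infty\}$ (with $x\le+\infty$, $x\ge -\infty$ always true and $x\ge+\infty$, $x\le-\infty$ never true). A bend on variables $x,y$ is a formula $x \circ_1 d_1 \vee (a_1 x + a_2 y) \circ c \vee y \circ_2 d_2$ where $\circ \in \{\leq,<\}$, $\circ_1,\circ_2 \in \{\leq,\geq,<,>\}$, $a_1,a_2 \in \mathbb{Q}\setminus\{0\}$, $c,d_1,d_2 \in \mathbb{Q}\cup\{-\infty,+\infty\}$, and for $i=1,2$, $\circ_i \in \{\leq,<\}$ if and only if $a_i>0$. Formulas obtained from a bend by removing disjuncts (in particular bounds, two-variable linear inequalities $ax+by\le c$ or $ax+by<c$, disjunctions of two bounds $x\circ_1 d_1 \vee x \circ_2 d_2$, true and false) are also regarded as bends. A bijunctive formula is a finite conjunction of bends. *)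

theory Defs
  imports Complex_Main "HOL-Library.Extended" "HOL-Library.Multiset"
begin

text \<open>A tuple in \<open>\<rat>\<^sup>k\<close> is a list of length \<open>k\<close>; the variables \<open>x\<^sub>1, \<dots>, x\<^sub>k\<close> are the indices \<open>0, \<dots>, k - 1\<close>.\<close>

definition tuples :: "nat \<Rightarrow> rat list set" where
  "tuples k = {xs. length xs = k}"


subsection \<open>First-order definability over \<open>(\<rat>; +, 1, \<le>)\<close>\<close>

datatype fo_term = Var nat | One | Plus fo_term fo_term

datatype fo_form =
    Eq fo_term fo_term
  | Leq fo_term fo_term
  | Neg fo_form
  | Conj fo_form fo_form
  | Ex nat fo_form

primrec term_val :: "(nat \<Rightarrow> rat) \<Rightarrow> fo_term \<Rightarrow> rat" where
  "term_val v (Var i) = v i"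
| "term_val v One = 1"
| "term_val v (Plus s t) = term_val v s + term_val v t"

primrec fo_sat :: "(nat \<Rightarrow> rat) \<Rightarrow> fo_form \<Rightarrow> bool" where
  "fo_sat v (Eq s t) \<longleftrightarrow> term_val v s = term_val v t"
| "fo_sat v (Leq s t) \<longleftrightarrow> term_val v s \<le> term_val v t"
| "fo_sat v (Neg \<phi>) \<longleftrightarrow> \<not> fo_sat v \<phi>"
| "fo_sat v (Conj \<phi> \<psi>) \<longleftrightarrow> fo_sat v \<phi> \<and> fo_sat v \<psi>"
| "fo_sat v (Ex i \<phi>) \<longleftrightarrow> (\<exists>q. fo_sat (v(i := q)) \<phi>)"

primrec term_vars :: "fo_term \<Rightarrow> nat set" where
  "term_vars (Var i) = {i}"
| "term_vars One = {}"
| "term_vars (Plus s t) = term_vars s \<union> term_vars t"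

primrec free_vars :: "fo_form \<Rightarrow> nat set" where
  "free_vars (Eq s t) = term_vars s \<union> term_vars t"
| "free_vars (Leq s t) = term_vars s \<union> term_vars t"
| "free_vars (Neg \<phi>) = free_vars \<phi>"
| "free_vars (Conj \<phi> \<psi>) = free_vars \<phi> \<union> free_vars \<psi>"
| "free_vars (Ex i \<phi>) = free_vars \<phi> - {i}"

text \<open>The valuation \<open>(!) xs\<close> is meaningful only below \<open>k\<close>; the condition on the free variables makes its
  other values irrelevant.\<close>

definition semilinear :: "nat \<Rightarrow> rat list set \<Rightarrow> bool" where
  "semilinear k R \<longleftrightarrow>
     (\<exists>\<phi>. free_vars \<phi> \<subseteq> {..<k} \<and> R = {xs \<in> tuples k. fo_sat ((!) xs) \<phi>})"


subsection \<open>Median and preservation\<close>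

definition median :: "rat \<Rightarrow> rat \<Rightarrow> rat \<Rightarrow> rat" where
  "median x y z = sort [x, y, z] ! 1"

lemma median_middle:
  assumes "{#u, v, w#} = {#x, y, z#}" and "u \<le> v" and "v \<le> w"
  shows "median x y z = v"
proof -
  have "sort [x, y, z] = [u, v, w]"
    by (rule properties_for_sort) (use assms in \<open>simp_all\<close>)
  then show ?thesis
    by (simp add: median_def)
qed

definition preserves :: "(rat \<Rightarrow> rat \<Rightarrow> rat \<Rightarrow> rat) \<Rightarrow> nat \<Rightarrow> rat list set \<Rightarrow> bool" where
  "preserves f k R \<longleftrightarrow>
     (\<forall>x\<in>R. \<forall>y\<in>R. \<forall>z\<in>R. map (\<lambda>i. f (x ! i) (y ! i) (z ! i)) [0..<k] \<in> R)"


subsection \<open>Conjunctions of binary constraints\<close>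

definition quadrant_property :: "(rat \<times> rat) set \<Rightarrow> bool" where
  "quadrant_property S \<longleftrightarrow>
     (\<forall>u v. (u, v) \<in> - S \<longrightarrow>
        {(u', v') | u' v'. u' \<ge> u \<and> v' \<ge> v} \<subseteq> - S \<or>
        {(u', v') | u' v'. u' \<ge> u \<and> v' \<le> v} \<subseteq> - S \<or>
        {(u', v') | u' v'. u' \<le> u \<and> v' \<ge> v} \<subseteq> - S \<or>
        {(u', v') | u' v'. u' \<le> u \<and> v' \<le> v} \<subseteq> - S \<or>
        {(u', v) | u'. True} \<subseteq> - S \<or>
        {(u, v') | v'. True} \<subseteq> - S)"

text \<open>A triple \<open>(S, i, j)\<close> stands for the atomic formula \<open>S(x\<^sub>i, x\<^sub>j)\<close>; \<open>i = j\<close> is allowed.\<close>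

definition binary_definable :: "((rat \<times> rat) set \<Rightarrow> bool) \<Rightarrow> nat \<Rightarrow> rat list set \<Rightarrow> bool" where
  "binary_definable P k R \<longleftrightarrow>
     (\<exists>C :: ((rat \<times> rat) set \<times> nat \<times> nat) set. finite C \<and>
        (\<forall>(S, i, j)\<in>C. P S \<and> i < k \<and> j < k) \<and>
        R = {xs \<in> tuples k. \<forall>(S, i, j)\<in>C. (xs ! i, xs ! j) \<in> S})"


subsection \<open>Bijunctive formulas\<close>

datatype cmp = LE | LT | GE | GT

fun cmp_holds :: "cmp \<Rightarrow> rat \<Rightarrow> rat extended \<Rightarrow> bool" where
  "cmp_holds LE q d \<longleftrightarrow> Fin q \<le> d"
| "cmp_holds LT q d \<longleftrightarrow> Fin q < d"
| "cmp_holds GE q d \<longleftrightarrow> Fin q \<ge> d"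
| "cmp_holds GT q d \<longleftrightarrow> Fin q > d"

text \<open>\<open>Bound x r d\<close> is \<open>x \<circ> d\<close>, and \<open>Lin a x b y r c\<close> is \<open>a x + b y \<circ> c\<close>, where \<open>\<circ>\<close> is the comparison \<open>r\<close>.\<close>

datatype literal =
    Bound nat cmp "rat extended"
  | Lin rat nat rat nat cmp "rat extended"

fun lit_sat :: "(nat \<Rightarrow> rat) \<Rightarrow> literal \<Rightarrow> bool" where
  "lit_sat v (Bound x r d) \<longleftrightarrow> cmp_holds r (v x) d"
| "lit_sat v (Lin a x b y r c) \<longleftrightarrow> cmp_holds r (a * v x + b * v y) c"

fun lit_vars :: "literal \<Rightarrow> nat set" where
  "lit_vars (Bound x r d) = {x}"
| "lit_vars (Lin a x b y r c) = {x, y}"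

text \<open>A set of literals is read as their disjunction. The variables \<open>x\<close> and \<open>y\<close> of a bend may coincide, as is
  needed for disjunctions such as \<open>x \<le> 0 \<or> x \<ge> 1\<close>.\<close>

definition full_bend :: "literal set \<Rightarrow> bool" where
  "full_bend B \<longleftrightarrow>
     (\<exists>x y r r\<^sub>1 r\<^sub>2 a\<^sub>1 a\<^sub>2 c d\<^sub>1 d\<^sub>2.
        r \<in> {LE, LT} \<and> a\<^sub>1 \<noteq> 0 \<and> a\<^sub>2 \<noteq> 0 \<and>
        (r\<^sub>1 \<in> {LE, LT} \<longleftrightarrow> a\<^sub>1 > 0) \<and> (r\<^sub>2 \<in> {LE, LT} \<longleftrightarrow> a\<^sub>2 > 0) \<and>
        B = {Bound x r\<^sub>1 d\<^sub>1, Lin a\<^sub>1 x a\<^sub>2 y r c, Bound y r\<^sub>2 d\<^sub>2})"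

definition bend :: "literal set \<Rightarrow> bool" where
  "bend B \<longleftrightarrow> (\<exists>B'. full_bend B' \<and> B \<subseteq> B')"

text \<open>A set of bends is read as their conjunction.\<close>

definition bijunctive :: "literal set set \<Rightarrow> bool" where
  "bijunctive F \<longleftrightarrow> finite F \<and> (\<forall>B\<in>F. bend B)"

definition bijunctive_definable :: "nat \<Rightarrow> rat list set \<Rightarrow> bool" where
  "bijunctive_definable k R \<longleftrightarrow>
     (\<exists>F. bijunctive F \<and> (\<forall>B\<in>F. \<forall>l\<in>B. lit_vars l \<subseteq> {..<k}) \<and>
        R = {xs \<in> tuples k. \<forall>B\<in>F. \<exists>l\<in>B. lit_sat ((!) xs) l})"

end

theory Submission
  imports Defs
begin

text \<open>
  Bends have the quadrant property and the quadrant property is preserved by the median, so the point is to turn a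
  median-closed semilinear relation into a conjunction of bends. Since the median is a majority operation, such a
  relation is determined by its binary projections (Baker--Pixley), which are again semilinear and median-closed. If
  \<open>(u, v)\<close> is not in a median-closed binary relation \<open>S\<close>, then one of the four closed quadrants, the row or the
  column at \<open>(u, v)\<close> misses \<open>S\<close>; hence the complement of \<open>S\<close> is a union of four semilinear sets, each closed upwards
  in both coordinates after a reflection, and of full rows and columns. Excluding finitely many intervals of rows takes
  finitely many bends on a single variable, and a semilinear up-set is a finite union of complements of bends, because
  its lower boundary is a staircase with finitely many linear pieces.

  Semilinearity enters only through the following consequence of quantifier elimination, which a back-and-forth argument
  gives directly: membership depends only on the signs of finitely many affine forms.
\<close>

text \<open>With sorting replaced by a lattice term, every order fact about the median becomes a
  case split on \<open>max\<close> and \<open>min\<close>.\<close>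

lemma median_max_min: "median x y z = max (min x y) (min (max x y) z)"
  by (auto simp: median_def max_def min_def)

lemma median_agree:
  "median x x y = x" "median x y x = x" "median y x x = x"
  by (auto simp: median_max_min max_def min_def)

section \<open>Sign-determined predicates and quantifier elimination\<close>

text \<open>Affine forms are functions of a valuation rather than coefficient vectors, so no number
  of variables is fixed; coefficients are recovered by induction where they are needed.\<close>

inductive affine_form :: "((nat \<Rightarrow> rat) \<Rightarrow> rat) \<Rightarrow> bool" where
  const: "affine_form (\<lambda>v. c)"
| var: "affine_form (\<lambda>v. v i)"
| add: "affine_form l \<Longrightarrow> affine_form m \<Longrightarrow> affine_form (\<lambda>v. l v + m v)"
| scale: "affine_form l \<Longrightarrow> affine_form (\<lambda>v. c * l v)"

lemma affine_form_diff:
  assumes "affine_form l" "affine_form m"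
  shows "affine_form (\<lambda>v. l v - m v)"
  using affine_form.add[OF assms(1) affine_form.scale[OF assms(2), of "-1"]] by simp

lemma affine_form_split:
  assumes "affine_form l"
  shows "\<exists>m a. affine_form m \<and> (\<forall>v q. l (v(i := q)) = m v + a * q)"
  using assms
proof induction
  case (const c)
  show ?case
    by (intro exI[of _ "\<lambda>v. c"] exI[of _ 0]) (auto intro: affine_form.intros)
next
  case (var j)
  show ?case
  proof (cases "j = i")
    case True
    then show ?thesis
      by (intro exI[of _ "\<lambda>v. 0"] exI[of _ 1]) (auto intro: affine_form.intros)
  next
    case False
    then show ?thesis
      by (intro exI[of _ "\<lambda>v. v j"] exI[of _ 0]) (auto intro: affine_form.intros)
  qed
next
  case (add l m)
  then obtain l' a m' b where "affine_form l'" "affine_form m'"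
    "\<forall>v q. l (v(i := q)) = l' v + a * q" "\<forall>v q. m (v(i := q)) = m' v + b * q"
    by blast
  then show ?case
    by (intro exI[of _ "\<lambda>v. l' v + m' v"] exI[of _ "a + b"])
      (auto intro: affine_form.intros simp: distrib_right simp del: fun_upd_apply)
next
  case (scale l c)
  then obtain l' a where "affine_form l'" "\<forall>v q. l (v(i := q)) = l' v + a * q"
    by blast
  then show ?case
    by (intro exI[of _ "\<lambda>v. c * l' v"] exI[of _ "c * a"])
      (auto intro: affine_form.intros simp: distrib_left simp del: fun_upd_apply)
qed

text \<open>The semantic counterpart of a quantifier-free formula: \<open>P\<close> is a union of
  classes of valuations with equal sign vectors. One implication suffices because the sign condition
  is symmetric in \<open>v\<close> and \<open>w\<close>.\<close>

definition sign_determined :: "((nat \<Rightarrow> rat) \<Rightarrow> bool) \<Rightarrow> bool" where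
  "sign_determined P \<longleftrightarrow> (\<exists>L. finite L \<and> (\<forall>l\<in>L. affine_form l) \<and>
     (\<forall>v w. (\<forall>l\<in>L. sgn (l v) = sgn (l w)) \<longrightarrow> P v \<longrightarrow> P w))"

lemma sign_determinedI:
  assumes "finite L" "\<And>l. l \<in> L \<Longrightarrow> affine_form l"
    and "\<And>v w. \<forall>l\<in>L. sgn (l v) = sgn (l w) \<Longrightarrow> P v \<Longrightarrow> P w"
  shows "sign_determined P"
  unfolding sign_determined_def using assms by blast

lemma sign_determinedE:
  assumes "sign_determined P"
  obtains L where "finite L" "\<And>l. l \<in> L \<Longrightarrow> affine_form l"
    "\<And>v w. \<forall>l\<in>L. sgn (l v) = sgn (l w) \<Longrightarrow> P v \<Longrightarrow> P w"
  using assms unfolding sign_determined_def by blast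

lemma sign_determined_eq:
  assumes "affine_form l" "affine_form m"
  shows "sign_determined (\<lambda>v. l v = m v)"
proof (rule sign_determinedI[of "{\<lambda>v. l v - m v}"])
  fix v w :: "nat \<Rightarrow> rat"
  assume "\<forall>f\<in>{\<lambda>v. l v - m v}. sgn (f v) = sgn (f w)"
  then have "sgn (l v - m v) = sgn (l w - m w)"
    by simp
  then show "l v = m v \<Longrightarrow> l w = m w"
    by (auto simp: sgn_if split: if_splits)
qed (use affine_form_diff[OF assms] in auto)

lemma sign_determined_le:
  assumes "affine_form l" "affine_form m"
  shows "sign_determined (\<lambda>v. l v \<le> m v)"
proof (rule sign_determinedI[of "{\<lambda>v. l v - m v}"])
  fix v w :: "nat \<Rightarrow> rat"
  assume "\<forall>f\<in>{\<lambda>v. l v - m v}. sgn (f v) = sgn (f w)"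
  then have "sgn (l v - m v) = sgn (l w - m w)"
    by simp
  then show "l v \<le> m v \<Longrightarrow> l w \<le> m w"
    by (auto simp: sgn_if split: if_splits)
qed (use affine_form_diff[OF assms] in auto)

lemma sign_determined_not:
  assumes "sign_determined P"
  shows "sign_determined (\<lambda>v. \<not> P v)"
proof -
  obtain L where L: "finite L" "\<And>l. l \<in> L \<Longrightarrow> affine_form l"
    "\<And>v w. \<forall>l\<in>L. sgn (l v) = sgn (l w) \<Longrightarrow> P v \<Longrightarrow> P w"
    using sign_determinedE[OF assms] by blast
  show ?thesis
  proof (rule sign_determinedI[of L])
    fix v w
    assume s: "\<forall>l\<in>L. sgn (l v) = sgn (l w)" and "\<not> P v"
    then show "\<not> P w"
      using L(3)[of w v] by auto
  qed (use L(1,2) in auto)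
qed

lemma sign_determined_conj:
  assumes "sign_determined P" "sign_determined Q"
  shows "sign_determined (\<lambda>v. P v \<and> Q v)"
proof -
  obtain L where L: "finite L" "\<And>l. l \<in> L \<Longrightarrow> affine_form l"
    "\<And>v w. \<forall>l\<in>L. sgn (l v) = sgn (l w) \<Longrightarrow> P v \<Longrightarrow> P w"
    using sign_determinedE[OF assms(1)] by blast
  obtain M where M: "finite M" "\<And>l. l \<in> M \<Longrightarrow> affine_form l"
    "\<And>v w. \<forall>l\<in>M. sgn (l v) = sgn (l w) \<Longrightarrow> Q v \<Longrightarrow> Q w"
    using sign_determinedE[OF assms(2)] by blast
  show ?thesis
  proof (rule sign_determinedI[of "L \<union> M"])
    fix v w
    assume s: "\<forall>l\<in>L \<union> M. sgn (l v) = sgn (l w)" and "P v \<and> Q v"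
    then show "P w \<and> Q w"
      using L(3)[of v w] M(3)[of v w] by blast
  qed (use L(1,2) M(1,2) in auto)
qed

section \<open>Elimination of one existential quantifier\<close>

lemma finite_separated:
  fixes A B :: "rat set"
  assumes "finite A" "finite B" "\<And>a b. a \<in> A \<Longrightarrow> b \<in> B \<Longrightarrow> a < b"
  shows "\<exists>q. (\<forall>a\<in>A. a < q) \<and> (\<forall>b\<in>B. q < b)"
proof (cases "A = {}")
  case True
  then show ?thesis
  proof (cases "B = {}")
    case False
    have "Min B - 1 < b" if "b \<in> B" for b
      using Min_le[OF assms(2) that] by linarith
    then show ?thesis
      using True by (intro exI[of _ "Min B - 1"]) simp
  qed simp
next
  case A: False
  show ?thesis
  proof (cases "B = {}")
    case True
    have "a < Max A + 1" if "a \<in> A" for a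
      using Max_ge[OF assms(1) that] by linarith
    then show ?thesis
      using True by (intro exI[of _ "Max A + 1"]) simp
  next
    case False
    then have "Max A < Min B"
      using assms A by simp
    then obtain q where "Max A < q" "q < Min B"
      using dense by blast
    then show ?thesis
      using assms A False by auto
  qed
qed

text \<open>One round of a back-and-forth game. If \<open>q\<close> equals some \<open>z h\<close>,
  its copy is \<open>z' h\<close>; otherwise the images of the points below \<open>q\<close> lie
  below the images of those above it, and the rationals, being dense and unbounded, have room for
  \<open>q'\<close>.\<close>

lemma transfer_point:
  fixes z z' :: "'a \<Rightarrow> rat"
  assumes "finite G"
    and same: "\<And>g h. g \<in> G \<Longrightarrow> h \<in> G \<Longrightarrow> sgn (z g - z h) = sgn (z' g - z' h)"
  shows "\<exists>q'. \<forall>g\<in>G. sgn (q - z g) = sgn (q' - z' g)"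
proof (cases "\<exists>g\<in>G. q = z g")
  case True
  then obtain h where "h \<in> G" "q = z h"
    by blast
  then show ?thesis
    using same by (intro exI[of _ "z' h"]) simp
next
  case False
  have sep: "a < b" if ab: "a \<in> z' ` {g \<in> G. z g < q}" "b \<in> z' ` {g \<in> G. q < z g}" for a b
  proof -
    obtain g h where gh: "g \<in> G" "h \<in> G" "z g < q" "q < z h" "a = z' g" "b = z' h"
      using ab by blast
    then have "sgn (z g - z h) = -1"
      by (simp add: sgn_if)
    then show ?thesis
      using same[OF gh(1,2)] gh by (auto simp: sgn_if split: if_splits)
  qed
  have "finite (z' ` {g \<in> G. z g < q})" "finite (z' ` {g \<in> G. q < z g})"
    using assms(1) by simp_all
  from finite_separated[OF this sep]
  obtain q' where "\<forall>a\<in>z' ` {g \<in> G. z g < q}. a < q'" "\<forall>b\<in>z' ` {g \<in> G. q < z g}. q' < b"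
    by blast
  then have q': "\<And>g. g \<in> G \<Longrightarrow> z g < q \<Longrightarrow> z' g < q'" "\<And>g. g \<in> G \<Longrightarrow> q < z g \<Longrightarrow> q' < z' g"
    by simp_all
  have "sgn (q - z g) = sgn (q' - z' g)" if "g \<in> G" for g
    using q'[OF that] False that by (cases "z g" q rule: linorder_cases) (auto simp: sgn_if)
  then show ?thesis
    by blast
qed

text \<open>A form containing variable \<open>i\<close> is its leading coefficient times the signed
  distance of \<open>q\<close> from its root, so only the side of the root matters. Once the roots
  for \<open>v\<close> and \<open>w\<close> are ordered alike, \<open>transfer_point\<close>
  supplies the witness for \<open>w\<close>.\<close>

lemma sign_determined_ex:
  assumes "sign_determined P"
  shows "sign_determined (\<lambda>v. \<exists>q. P (v(i := q)))"
proof -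
  obtain L where L: "finite L" "\<And>l. l \<in> L \<Longrightarrow> affine_form l"
    "\<And>v w. \<forall>l\<in>L. sgn (l v) = sgn (l w) \<Longrightarrow> P v \<Longrightarrow> P w"
    using sign_determinedE[OF assms] by blast
  have "\<forall>l\<in>L. \<exists>m a. affine_form m \<and> (\<forall>v q. l (v(i := q)) = m v + a * q)"
    using affine_form_split L(2) by blast
  then obtain base coef where bc: "\<And>l. l \<in> L \<Longrightarrow> affine_form (base l)"
    "\<And>l v q. l \<in> L \<Longrightarrow> l (v(i := q)) = base l v + coef l * q"
    by metis
  \<comment> \<open>\<open>z v l\<close> is the root of \<open>l\<close> in variable
    \<open>i\<close>. If \<open>coef l = 0\<close>, division by zero makes it 0, which only adds
    harmless comparisons.\<close>
  define z where "z v l = - (1 / coef l) * base l v" for v l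
  have aff_z: "affine_form (\<lambda>v. z v l)" if "l \<in> L" for l
    unfolding z_def using bc(1)[OF that] by (rule affine_form.scale)
  have l_z: "l (v(i := q)) = coef l * (q - z v l)" if "l \<in> L" "coef l \<noteq> 0" for l v q
    using that by (simp add: bc(2) z_def field_simps)
  \<comment> \<open>The bases give the signs of the forms free of variable \<open>i\<close>; the
    differences fix the order of the roots.\<close>
  define L' where "L' = base ` L \<union> (\<lambda>(l, m) v. z v l - z v m) ` (L \<times> L)"
  show ?thesis
  proof (rule sign_determinedI[of L'])
    show "finite L'"
      using L(1) by (simp add: L'_def)
    show "affine_form l" if "l \<in> L'" for l
      using that bc(1) aff_z affine_form_diff by (auto simp: L'_def)
    fix v w
    assume s: "\<forall>l\<in>L'. sgn (l v) = sgn (l w)" and "\<exists>q. P (v(i := q))"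
    then obtain q where q: "P (v(i := q))"
      by blast
    have "sgn (z v l - z v m) = sgn (z w l - z w m)" if "l \<in> L" "m \<in> L" for l m
      using bspec[OF s, of "\<lambda>v. z v l - z v m"] that by (force simp: L'_def)
    then obtain q' where q': "\<forall>l\<in>L. sgn (q - z v l) = sgn (q' - z w l)"
      using transfer_point[OF L(1)] by blast
    have "sgn (l (v(i := q))) = sgn (l (w(i := q')))" if "l \<in> L" for l
    proof (cases "coef l = 0")
      case True
      then show ?thesis
        using that bspec[OF s, of "base l"] by (simp add: bc(2) L'_def)
    next
      case False
      then show ?thesis
        using that q' by (simp add: l_z sgn_mult)
    qed
    then show "\<exists>q. P (w(i := q))"
      using L(3)[of "v(i := q)" "w(i := q')"] q by blast
  qed
qed

section \<open>First-order formulas\<close>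

lemma affine_form_term_val: "affine_form (\<lambda>v. term_val v t)"
  by (induction t) (simp_all add: affine_form.const affine_form.var affine_form.add)

lemma sign_determined_fo_sat: "sign_determined (\<lambda>v. fo_sat v \<phi>)"
proof (induction \<phi>)
  case (Neg \<phi>)
  show ?case
    using sign_determined_not[OF Neg.IH] by simp
next
  case (Conj \<phi> \<psi>)
  show ?case
    using sign_determined_conj[OF Conj.IH] by simp
next
  case (Ex i \<phi>)
  show ?case
    using sign_determined_ex[OF Ex.IH, of i] by (simp del: fun_upd_apply)
next
  case (Eq s t)
  show ?case
    using sign_determined_eq[OF affine_form_term_val affine_form_term_val] by simp
next
  case (Leq s t)
  show ?case
    using sign_determined_le[OF affine_form_term_val affine_form_term_val] by simp
qed

text \<open>Quantifying over whole valuations that are fixed from \<open>n\<close> on eliminates the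
  first \<open>n\<close> variables together; each induction step peels off one more. This is what
  projecting a \<open>k\<close>-ary relation requires.\<close>

lemma sign_determined_ex_below:
  assumes "sign_determined P"
  shows "sign_determined (\<lambda>v. \<exists>w. (\<forall>m\<ge>n. w m = v m) \<and> P w)"
proof (induction n)
  case 0
  have "(\<lambda>v. \<exists>w. (\<forall>m\<ge>0. w m = v m) \<and> P w) = P"
  proof
    fix v :: "nat \<Rightarrow> rat"
    have "(\<forall>m\<ge>0. w m = v m) \<longleftrightarrow> w = v" for w
      by (auto simp: fun_eq_iff)
    then show "(\<exists>w. (\<forall>m\<ge>0. w m = v m) \<and> P w) = P v"
      by simp
  qed
  then show ?case
    using assms by (simp only:)
next
  case (Suc n)
  have "(\<exists>w. (\<forall>m\<ge>Suc n. w m = v m) \<and> P w) = (\<exists>q. \<exists>w. (\<forall>m\<ge>n. w m = (v(n := q)) m) \<and> P w)" for v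
  proof
    assume "\<exists>w. (\<forall>m\<ge>Suc n. w m = v m) \<and> P w"
    then obtain w where "\<forall>m\<ge>Suc n. w m = v m" "P w"
      by blast
    then show "\<exists>q. \<exists>w. (\<forall>m\<ge>n. w m = (v(n := q)) m) \<and> P w"
      by (intro exI[of _ "w n"] exI[of _ w]) auto
  next
    assume "\<exists>q. \<exists>w. (\<forall>m\<ge>n. w m = (v(n := q)) m) \<and> P w"
    then obtain q w where "\<forall>m\<ge>n. w m = (v(n := q)) m" "P w"
      by blast
    then show "\<exists>w. (\<forall>m\<ge>Suc n. w m = v m) \<and> P w"
      by (intro exI[of _ w]) auto
  qed
  then show ?case
    using sign_determined_ex[OF Suc.IH, of n] by (simp only:)
qed

lemma term_val_cong: "(\<And>i. i \<in> term_vars t \<Longrightarrow> v i = w i) \<Longrightarrow> term_val v t = term_val w t"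
  by (induction t) auto

lemma fo_sat_cong: "(\<And>i. i \<in> free_vars \<phi> \<Longrightarrow> v i = w i) \<Longrightarrow> fo_sat v \<phi> = fo_sat w \<phi>"
proof (induction \<phi> arbitrary: v w)
  case (Eq s t)
  then show ?case
    using term_val_cong[of s v w] term_val_cong[of t v w] by simp
next
  case (Leq s t)
  then show ?case
    using term_val_cong[of s v w] term_val_cong[of t v w] by simp
next
  case (Neg \<phi>)
  show ?case
    using Neg.IH[of v w] Neg.prems by simp
next
  case (Conj \<phi> \<psi>)
  show ?case
    using Conj.IH[of v w] Conj.prems by simp
next
  case (Ex i \<phi>)
  have "fo_sat (v(i := q)) \<phi> = fo_sat (w(i := q)) \<phi>" for q
    by (rule Ex.IH) (use Ex.prems in auto)
  then show ?case
    by simp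
qed

section \<open>Semilinear relations in the plane\<close>

text \<open>Sign determination in two variables, with the forms given by explicit coefficients
  because the geometric arguments compute slopes, intercepts and crossings from them.\<close>

definition plane_semilinear :: "(rat \<times> rat) set \<Rightarrow> bool" where
  "plane_semilinear S \<longleftrightarrow> (\<exists>L. finite L \<and> (\<forall>x y x' y'.
     (\<forall>(a, b, c)\<in>L. sgn (a * x + b * y + c) = sgn (a * x' + b * y' + c)) \<longrightarrow> (x, y) \<in> S \<longrightarrow> (x', y') \<in> S))"

lemma plane_semilinear_sign_determined:
  assumes "plane_semilinear S"
  shows "sign_determined (\<lambda>v. (v i, v j) \<in> S)"
proof -
  obtain L where L: "finite L" "\<And>x y x' y'. (\<forall>(a, b, c)\<in>L. sgn (a * x + b * y + c) = sgn (a * x' + b * y' + c))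
    \<Longrightarrow> (x, y) \<in> S \<Longrightarrow> (x', y') \<in> S"
    using assms unfolding plane_semilinear_def by blast
  show ?thesis
  proof (rule sign_determinedI[of "(\<lambda>(a, b, c) v. a * v i + b * v j + c) ` L"])
    fix v w
    assume s: "\<forall>l\<in>(\<lambda>(a, b, c) v. a * v i + b * v j + c) ` L. sgn (l v) = sgn (l w)"
    have "\<forall>(a, b, c)\<in>L. sgn (a * v i + b * v j + c) = sgn (a * w i + b * w j + c)"
    proof clarify
      fix a b c
      assume "(a, b, c) \<in> L"
      then show "sgn (a * v i + b * v j + c) = sgn (a * w i + b * w j + c)"
        using bspec[OF s, of "\<lambda>v. a * v i + b * v j + c"] by force
    qed
    then show "(v i, v j) \<in> S \<Longrightarrow> (w i, w j) \<in> S"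
      by (rule L(2))
  next
    show "affine_form l" if "l \<in> (\<lambda>(a, b, c) v. a * v i + b * v j + c) ` L" for l
      using that by (auto simp: affine_form.const affine_form.var affine_form.scale affine_form.add)
  qed (use L(1) in simp)
qed

lemma sign_determined_plane_semilinear:
  assumes "sign_determined (\<lambda>v. (v i, v j) \<in> S)" "i \<noteq> j"
  shows "plane_semilinear S"
proof -
  \<comment> \<open>On valuations that vanish outside \<open>i\<close> and \<open>j\<close>, every
    affine form becomes an affine function of two numbers, whose coefficients can be read off by
    induction.\<close>
  define val where "val x y = (\<lambda>_. 0 :: rat)(i := x, j := y)" for x y
  obtain L where L: "finite L" "\<And>l. l \<in> L \<Longrightarrow> affine_form l"
    "\<And>v w. \<forall>l\<in>L. sgn (l v) = sgn (l w) \<Longrightarrow> (v i, v j) \<in> S \<Longrightarrow> (w i, w j) \<in> S"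
    using sign_determinedE[OF assms(1)] by blast
  have "\<exists>a b c. \<forall>x y. l (val x y) = a * x + b * y + c" if "affine_form l" for l
    using that
  proof induction
    case (const c)
    show ?case
      by (intro exI[of _ 0] exI[of _ c]) simp
  next
    case (var m)
    show ?case
      using assms(2)
      by (intro exI[of _ "of_bool (m = i)"] exI[of _ "of_bool (m = j)"] exI[of _ 0]) (auto simp: val_def)
  next
    case (add l m)
    then obtain a b c a' b' c' where "\<forall>x y. l (val x y) = a * x + b * y + c"
      "\<forall>x y. m (val x y) = a' * x + b' * y + c'"
      by blast
    then show ?case
      by (intro exI[of _ "a + a'"] exI[of _ "b + b'"] exI[of _ "c + c'"]) (auto simp: algebra_simps)
  next
    case (scale l d)
    then obtain a b c where "\<forall>x y. l (val x y) = a * x + b * y + c"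
      by blast
    then show ?case
      by (intro exI[of _ "d * a"] exI[of _ "d * b"] exI[of _ "d * c"]) (auto simp: algebra_simps)
  qed
  then have "\<forall>l\<in>L. \<exists>a b c. \<forall>x y. l (val x y) = a * x + b * y + c"
    using L(2) by blast
  then obtain a b c where abc: "\<And>l x y. l \<in> L \<Longrightarrow> l (val x y) = a l * x + b l * y + c l"
    by metis
  have "(x', y') \<in> S" if s: "\<forall>(a, b, c)\<in>(\<lambda>l. (a l, b l, c l)) ` L.
    sgn (a * x + b * y + c) = sgn (a * x' + b * y' + c)" and "(x, y) \<in> S" for x y x' y'
    using L(3)[of "val x y" "val x' y'"] abc that assms(2) by (auto simp: val_def)
  moreover have "finite ((\<lambda>l. (a l, b l, c l)) ` L)"
    using L(1) by simp
  ultimately show ?thesis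
    unfolding plane_semilinear_def by blast
qed

text \<open>For signs \<sigma> and \<tau> this is an involution permuting the four quadrant
  directions, so only the upper right one has to be treated.\<close>

definition reflect :: "rat \<Rightarrow> rat \<Rightarrow> (rat \<times> rat) set \<Rightarrow> (rat \<times> rat) set" where
  "reflect \<sigma> \<tau> S = {(x, y). (\<sigma> * x, \<tau> * y) \<in> S}"

lemma plane_semilinear_reflect:
  assumes "plane_semilinear S"
  shows "plane_semilinear (reflect \<sigma> \<tau> S)"
proof -
  obtain L where L: "finite L" "\<And>x y x' y'. (\<forall>(a, b, c)\<in>L. sgn (a * x + b * y + c) = sgn (a * x' + b * y' + c))
    \<Longrightarrow> (x, y) \<in> S \<Longrightarrow> (x', y') \<in> S"
    using assms unfolding plane_semilinear_def by blast
  show ?thesis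
    unfolding plane_semilinear_def
  proof (intro exI[of _ "(\<lambda>(a, b, c). (a * \<sigma>, b * \<tau>, c)) ` L"] conjI allI impI)
    fix x y x' y'
    assume s: "\<forall>(a, b, c)\<in>(\<lambda>(a, b, c). (a * \<sigma>, b * \<tau>, c)) ` L.
      sgn (a * x + b * y + c) = sgn (a * x' + b * y' + c)" and "(x, y) \<in> reflect \<sigma> \<tau> S"
    then show "(x', y') \<in> reflect \<sigma> \<tau> S"
      using L(2)[of "\<sigma> * x" "\<tau> * y" "\<sigma> * x'" "\<tau> * y'"]
      by (fastforce simp: reflect_def mult.assoc)
  qed (use L(1) in simp)
qed

lemma plane_semilinear_swap:
  assumes "plane_semilinear S"
  shows "plane_semilinear (prod.swap -` S)"
  using plane_semilinear_sign_determined[OF assms, of 1 0]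
  by (intro sign_determined_plane_semilinear[of 0 1]) auto

text \<open>Always an up-set, since the quadrant shrinks as its corner moves up or right.\<close>

definition quadrant_free :: "(rat \<times> rat) set \<Rightarrow> (rat \<times> rat) set" where
  "quadrant_free S = {(x, y). \<forall>x' y'. x \<le> x' \<longrightarrow> y \<le> y' \<longrightarrow> (x', y') \<notin> S}"

definition row_free :: "(rat \<times> rat) set \<Rightarrow> (rat \<times> rat) set" where
  "row_free S = {(x, y). \<forall>x'. (x', y) \<notin> S}"

lemma plane_semilinear_quadrant_free:
  assumes "plane_semilinear S"
  shows "plane_semilinear (quadrant_free S)"
proof (rule sign_determined_plane_semilinear[of 0 1])
  \<comment> \<open>Variables 0 and 1 hold the corner; 2 and 3 hold the point of \<open>S\<close>
    that is then quantified away.\<close>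
  have "sign_determined (\<lambda>v. v 0 \<le> v 2 \<and> v 1 \<le> v 3 \<and> (v 2, v 3) \<in> S)"
    by (intro sign_determined_conj sign_determined_le affine_form.var plane_semilinear_sign_determined assms)
  from sign_determined_not[OF sign_determined_ex[OF sign_determined_ex[OF this, of 3], of 2]]
  show "sign_determined (\<lambda>v. (v 0, v 1) \<in> quadrant_free S)"
    by (simp add: quadrant_free_def)
qed simp

lemma plane_semilinear_row_free:
  assumes "plane_semilinear S"
  shows "plane_semilinear (row_free S)"
proof (rule sign_determined_plane_semilinear[of 0 1])
  from sign_determined_not[OF sign_determined_ex[OF plane_semilinear_sign_determined[OF assms, of 2 1], of 2]]
  show "sign_determined (\<lambda>v. (v 0, v 1) \<in> row_free S)"
    by (simp add: row_free_def)
qed simp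

section \<open>Binary projections\<close>

definition proj2 :: "nat \<Rightarrow> nat \<Rightarrow> rat list set \<Rightarrow> (rat \<times> rat) set" where
  "proj2 i j R = (\<lambda>xs. (xs ! i, xs ! j)) ` R"

text \<open>Copies of the two projected values are kept in variables \<open>k\<close> and
  \<open>Suc k\<close>, outside the formula, and all variables below \<open>k\<close> are
  eliminated. The copies are distinct variables even if \<open>i = j\<close>.\<close>

lemma plane_semilinear_proj2:
  assumes "semilinear k R" "i < k" "j < k"
  shows "plane_semilinear (proj2 i j R)"
proof (rule sign_determined_plane_semilinear[of k "Suc k"])
  obtain \<phi> where \<phi>: "free_vars \<phi> \<subseteq> {..<k}" "R = {xs \<in> tuples k. fo_sat ((!) xs) \<phi>}"
    using assms(1) unfolding semilinear_def by blast
  have "sign_determined (\<lambda>v. fo_sat v \<phi> \<and> v i = v k \<and> v j = v (Suc k))"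
    by (intro sign_determined_conj sign_determined_fo_sat sign_determined_eq affine_form.var)
  note sd = sign_determined_ex_below[OF this, of k]
  have "(\<exists>w. (\<forall>m\<ge>k. w m = v m) \<and> fo_sat w \<phi> \<and> w i = w k \<and> w j = w (Suc k))
      \<longleftrightarrow> (v k, v (Suc k)) \<in> proj2 i j R" for v
  proof
    assume "\<exists>w. (\<forall>m\<ge>k. w m = v m) \<and> fo_sat w \<phi> \<and> w i = w k \<and> w j = w (Suc k)"
    then obtain w where w: "\<forall>m\<ge>k. w m = v m" "fo_sat w \<phi>" "w i = w k" "w j = w (Suc k)"
      by blast
    have "fo_sat ((!) (map w [0..<k])) \<phi> = fo_sat w \<phi>"
      by (rule fo_sat_cong) (use \<phi>(1) in auto)
    then have "map w [0..<k] \<in> R"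
      using w(2) by (simp add: \<phi>(2) tuples_def)
    then show "(v k, v (Suc k)) \<in> proj2 i j R"
      using w(1,3,4) assms(2,3) by (force simp: proj2_def)
  next
    assume "(v k, v (Suc k)) \<in> proj2 i j R"
    then obtain xs where xs: "xs \<in> R" "v k = xs ! i" "v (Suc k) = xs ! j"
      by (auto simp: proj2_def)
    define w where "w m = (if m < k then xs ! m else v m)" for m
    have "fo_sat w \<phi> = fo_sat ((!) xs) \<phi>"
      by (rule fo_sat_cong) (use \<phi>(1) in \<open>auto simp: w_def\<close>)
    then show "\<exists>w. (\<forall>m\<ge>k. w m = v m) \<and> fo_sat w \<phi> \<and> w i = w k \<and> w j = w (Suc k)"
      using xs assms(2,3) by (intro exI[of _ w]) (auto simp: w_def \<phi>(2))
  qed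
  then show "sign_determined (\<lambda>v. (v k, v (Suc k)) \<in> proj2 i j R)"
    using sd by simp
qed simp

section \<open>Complements of bends\<close>

text \<open>Quantifying over all \<open>i\<close> and \<open>j\<close>, equal ones included, lets a
  planar set be imposed on any pair of coordinates.\<close>

definition plane_bijunctive :: "(rat \<times> rat) set \<Rightarrow> bool" where
  "plane_bijunctive A \<longleftrightarrow> (\<forall>i j. \<exists>F. bijunctive F \<and> (\<forall>B\<in>F. \<forall>l\<in>B. lit_vars l \<subseteq> {i, j}) \<and>
     (\<forall>v. (v i, v j) \<in> A \<longleftrightarrow> (\<forall>B\<in>F. \<exists>l\<in>B. lit_sat v l)))"

lemma plane_bijunctive_bendI:
  assumes "\<And>i j. \<exists>B. bend B \<and> (\<forall>l\<in>B. lit_vars l \<subseteq> {i, j}) \<and> (\<forall>v. (v i, v j) \<in> A \<longleftrightarrow> (\<exists>l\<in>B. lit_sat v l))"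
  shows "plane_bijunctive A"
  unfolding plane_bijunctive_def
proof (intro allI)
  fix i j
  obtain B where "bend B" "\<forall>l\<in>B. lit_vars l \<subseteq> {i, j}" "\<forall>v. (v i, v j) \<in> A \<longleftrightarrow> (\<exists>l\<in>B. lit_sat v l)"
    using assms by blast
  then show "\<exists>F. bijunctive F \<and> (\<forall>B\<in>F. \<forall>l\<in>B. lit_vars l \<subseteq> {i, j}) \<and>
     (\<forall>v. (v i, v j) \<in> A \<longleftrightarrow> (\<forall>B\<in>F. \<exists>l\<in>B. lit_sat v l))"
    by (intro exI[of _ "{B}"]) (simp add: bijunctive_def)
qed

lemma plane_bijunctive_Inter:
  assumes "finite \<A>" "\<And>A. A \<in> \<A> \<Longrightarrow> plane_bijunctive A"
  shows "plane_bijunctive (\<Inter>\<A>)"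
  unfolding plane_bijunctive_def
proof (intro allI)
  fix i j
  have "\<forall>A\<in>\<A>. \<exists>F. bijunctive F \<and> (\<forall>B\<in>F. \<forall>l\<in>B. lit_vars l \<subseteq> {i, j}) \<and>
     (\<forall>v. (v i, v j) \<in> A \<longleftrightarrow> (\<forall>B\<in>F. \<exists>l\<in>B. lit_sat v l))"
    using assms(2) unfolding plane_bijunctive_def by blast
  then obtain F where F: "\<forall>A\<in>\<A>. bijunctive (F A) \<and> (\<forall>B\<in>F A. \<forall>l\<in>B. lit_vars l \<subseteq> {i, j}) \<and>
     (\<forall>v. (v i, v j) \<in> A \<longleftrightarrow> (\<forall>B\<in>F A. \<exists>l\<in>B. lit_sat v l))"
    unfolding bchoice_iff by (elim exE)
  have "bijunctive (\<Union>(F ` \<A>))"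
    using assms(1) F by (auto simp: bijunctive_def)
  moreover have "\<forall>B\<in>\<Union>(F ` \<A>). \<forall>l\<in>B. lit_vars l \<subseteq> {i, j}"
    using F by blast
  moreover have "(v i, v j) \<in> \<Inter>\<A> \<longleftrightarrow> (\<forall>B\<in>\<Union>(F ` \<A>). \<exists>l\<in>B. lit_sat v l)" for v
    using F by simp
  ultimately show "\<exists>F. bijunctive F \<and> (\<forall>B\<in>F. \<forall>l\<in>B. lit_vars l \<subseteq> {i, j}) \<and>
     (\<forall>v. (v i, v j) \<in> \<Inter>\<A> \<longleftrightarrow> (\<forall>B\<in>F. \<exists>l\<in>B. lit_sat v l))"
    by blast
qed

lemma plane_bijunctive_swap:
  assumes "plane_bijunctive A"
  shows "plane_bijunctive (prod.swap -` A)"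
  unfolding plane_bijunctive_def
proof (intro allI)
  fix i j
  show "\<exists>F. bijunctive F \<and> (\<forall>B\<in>F. \<forall>l\<in>B. lit_vars l \<subseteq> {i, j}) \<and>
     (\<forall>v. (v i, v j) \<in> prod.swap -` A \<longleftrightarrow> (\<forall>B\<in>F. \<exists>l\<in>B. lit_sat v l))"
    using assms[unfolded plane_bijunctive_def, rule_format, of j i] by (simp add: insert_commute)
qed

text \<open>The members of \<open>\<K>\<close> inside \<open>E\<close> have union \<open>E\<close>,
  so their complements intersect in \<open>- E\<close>. A finite stock of candidates thus allows the
  piece to be chosen separately for each point.\<close>

lemma plane_bijunctive_Compl_cover:
  assumes "finite \<K>" "\<And>A. A \<in> \<K> \<Longrightarrow> plane_bijunctive (- A)"
    and "\<And>p. p \<in> E \<Longrightarrow> \<exists>A\<in>\<K>. p \<in> A \<and> A \<subseteq> E"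
  shows "plane_bijunctive (- E)"
proof -
  have "- E = \<Inter>(uminus ` {A \<in> \<K>. A \<subseteq> E})"
    using assms(3) by blast
  moreover have "plane_bijunctive (\<Inter>(uminus ` {A \<in> \<K>. A \<subseteq> E}))"
    by (rule plane_bijunctive_Inter) (use assms(1,2) in auto)
  ultimately show ?thesis
    by simp
qed

text \<open>Setting \<open>c\<close> or \<open>d\<^sub>i\<close> to \<open>-\<infinity>\<close> makes the corresponding condition vacuous.\<close>

definition corner :: "cmp \<Rightarrow> rat extended \<Rightarrow> cmp \<Rightarrow> rat \<Rightarrow> rat \<Rightarrow> rat extended \<Rightarrow> cmp \<Rightarrow> rat extended \<Rightarrow> (rat \<times> rat) set" where
  "corner r\<^sub>1 d\<^sub>1 r a b c r\<^sub>2 d\<^sub>2 =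
     {(x, y). \<not> cmp_holds r\<^sub>1 x d\<^sub>1 \<and> \<not> cmp_holds r (a * x + b * y) c \<and> \<not> cmp_holds r\<^sub>2 y d\<^sub>2}"

text \<open>Complements of bends with two positive coefficients; the other sign patterns arise by
  reflection.\<close>

definition is_corner :: "(rat \<times> rat) set \<Rightarrow> bool" where
  "is_corner A \<longleftrightarrow> (\<exists>r\<^sub>1 d\<^sub>1 r a b c r\<^sub>2 d\<^sub>2. r\<^sub>1 \<in> {LE, LT} \<and> r \<in> {LE, LT} \<and> r\<^sub>2 \<in> {LE, LT} \<and>
     a > 0 \<and> b > 0 \<and> A = corner r\<^sub>1 d\<^sub>1 r a b c r\<^sub>2 d\<^sub>2)"

lemma is_cornerI:
  "r\<^sub>1 \<in> {LE, LT} \<Longrightarrow> r \<in> {LE, LT} \<Longrightarrow> r\<^sub>2 \<in> {LE, LT} \<Longrightarrow> a > 0 \<Longrightarrow> b > 0 \<Longrightarrow>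
     is_corner (corner r\<^sub>1 d\<^sub>1 r a b c r\<^sub>2 d\<^sub>2)"
  unfolding is_corner_def by metis

fun flip_cmp :: "cmp \<Rightarrow> cmp" where
  "flip_cmp LE = GE"
| "flip_cmp LT = GT"
| "flip_cmp GE = LE"
| "flip_cmp GT = LT"

lemma cmp_holds_flip: "cmp_holds (flip_cmp r) x (- d) = cmp_holds r (- x) d"
  by (cases r; cases d) auto

lemma bendI:
  assumes "r \<in> {LE, LT}" "a\<^sub>1 \<noteq> 0" "a\<^sub>2 \<noteq> 0" "r\<^sub>1 \<in> {LE, LT} \<longleftrightarrow> a\<^sub>1 > 0" "r\<^sub>2 \<in> {LE, LT} \<longleftrightarrow> a\<^sub>2 > 0"
    and "B \<subseteq> {Bound x r\<^sub>1 d\<^sub>1, Lin a\<^sub>1 x a\<^sub>2 y r c, Bound y r\<^sub>2 d\<^sub>2}"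
  shows "bend B"
proof -
  have "full_bend {Bound x r\<^sub>1 d\<^sub>1, Lin a\<^sub>1 x a\<^sub>2 y r c, Bound y r\<^sub>2 d\<^sub>2}"
    unfolding full_bend_def using assms(1-5) by metis
  then show ?thesis
    using assms(6) unfolding bend_def by metis
qed

text \<open>Negating a coordinate both flips the comparison of its bound and changes the sign of its
  coefficient, which respects the coupling of the two that a bend demands.\<close>

lemma plane_bijunctive_Compl_reflect_corner:
  assumes "is_corner A" "\<sigma> \<in> {1, -1}" "\<tau> \<in> {1, -1}"
  shows "plane_bijunctive (- reflect \<sigma> \<tau> A)"
proof (rule plane_bijunctive_bendI)
  fix i j
  obtain r\<^sub>1 d\<^sub>1 r a b c r\<^sub>2 d\<^sub>2 where A: "r\<^sub>1 \<in> {LE, LT}" "r \<in> {LE, LT}" "r\<^sub>2 \<in> {LE, LT}" "a > 0" "b > 0"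
    "A = corner r\<^sub>1 d\<^sub>1 r a b c r\<^sub>2 d\<^sub>2"
    using assms(1) unfolding is_corner_def by blast
  define s\<^sub>1 where "s\<^sub>1 = (if \<sigma> = 1 then r\<^sub>1 else flip_cmp r\<^sub>1)"
  define s\<^sub>2 where "s\<^sub>2 = (if \<tau> = 1 then r\<^sub>2 else flip_cmp r\<^sub>2)"
  define e\<^sub>1 where "e\<^sub>1 = (if \<sigma> = 1 then d\<^sub>1 else - d\<^sub>1)"
  define e\<^sub>2 where "e\<^sub>2 = (if \<tau> = 1 then d\<^sub>2 else - d\<^sub>2)"
  have holds: "cmp_holds s\<^sub>1 x e\<^sub>1 = cmp_holds r\<^sub>1 (\<sigma> * x) d\<^sub>1" "cmp_holds s\<^sub>2 x e\<^sub>2 = cmp_holds r\<^sub>2 (\<tau> * x) d\<^sub>2" for x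
    using assms(2,3) by (auto simp: s\<^sub>1_def s\<^sub>2_def e\<^sub>1_def e\<^sub>2_def cmp_holds_flip)
  let ?B = "{Bound i s\<^sub>1 e\<^sub>1, Lin (a * \<sigma>) i (b * \<tau>) j r c, Bound j s\<^sub>2 e\<^sub>2}"
  have "bend ?B"
    by (rule bendI[OF _ _ _ _ _ subset_refl]) (use A assms(2,3) in \<open>auto simp: s\<^sub>1_def s\<^sub>2_def\<close>)
  moreover have "(v i, v j) \<in> - reflect \<sigma> \<tau> A \<longleftrightarrow> (\<exists>l\<in>?B. lit_sat v l)" for v
    by (auto simp: A(6) reflect_def corner_def holds mult.assoc)
  ultimately show "\<exists>B. bend B \<and> (\<forall>l\<in>B. lit_vars l \<subseteq> {i, j}) \<and>
     (\<forall>v. (v i, v j) \<in> - reflect \<sigma> \<tau> A \<longleftrightarrow> (\<exists>l\<in>B. lit_sat v l))"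
    by (intro exI[of _ ?B]) auto
qed

section \<open>Complements of sets of full rows\<close>

lemma plane_bijunctive_Compl_strip:
  assumes "r\<^sub>1 \<in> {LE, LT}" "r\<^sub>2 \<in> {GE, GT}"
  shows "plane_bijunctive (- (UNIV \<times> {y. \<not> cmp_holds r\<^sub>1 y d\<^sub>1 \<and> \<not> cmp_holds r\<^sub>2 y d\<^sub>2}))"
proof (rule plane_bijunctive_bendI)
  fix i j
  let ?B = "{Bound j r\<^sub>1 d\<^sub>1, Bound j r\<^sub>2 d\<^sub>2}"
  have "bend ?B"
    \<comment> \<open>Both variables of the bend are \<open>j\<close>; the coefficients 1 and -1
      license opposite comparisons, and the linear disjunct is dropped, so its constant is
      arbitrary.\<close>
    by (rule bendI[of LE 1 "-1" r\<^sub>1 r\<^sub>2 _ j d\<^sub>1 j d\<^sub>1 d\<^sub>2]) (use assms in auto)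
  moreover have "(v i, v j) \<in> - (UNIV \<times> {y. \<not> cmp_holds r\<^sub>1 y d\<^sub>1 \<and> \<not> cmp_holds r\<^sub>2 y d\<^sub>2})
      \<longleftrightarrow> (\<exists>l\<in>?B. lit_sat v l)" for v :: "nat \<Rightarrow> rat"
    by auto
  ultimately show "\<exists>B. bend B \<and> (\<forall>l\<in>B. lit_vars l \<subseteq> {i, j}) \<and>
     (\<forall>v. (v i, v j) \<in> - (UNIV \<times> {y. \<not> cmp_holds r\<^sub>1 y d\<^sub>1 \<and> \<not> cmp_holds r\<^sub>2 y d\<^sub>2})
      \<longleftrightarrow> (\<exists>l\<in>B. lit_sat v l))"
    by (intro exI[of _ ?B]) auto
qed

text \<open>\<open>t\<close> and \<open>t'\<close> are the neighbours of \<open>x\<close> in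
  \<open>T\<close>, or infinite where there is none, so no point of \<open>T\<close> separates two
  numbers between them.\<close>

lemma cell_bounds:
  fixes x :: rat
  assumes "finite T" "x \<notin> T"
  obtains t t' where "t \<in> insert Minf (Fin ` T)" "t' \<in> insert Pinf (Fin ` T)" "t < Fin x" "Fin x < t'"
    "\<And>y. t < Fin y \<Longrightarrow> Fin y < t' \<Longrightarrow> \<forall>z\<in>T. sgn (x - z) = sgn (y - z)"
proof -
  define A where "A = {z \<in> T. z < x}"
  define B where "B = {z \<in> T. x < z}"
  define t where "t = (if A = {} then Minf else Fin (Max A))"
  define t' where "t' = (if B = {} then Pinf else Fin (Min B))"
  have fin: "finite A" "finite B"
    using assms(1) by (simp_all add: A_def B_def)
  have "Max A \<in> A" if "A \<noteq> {}"
    using fin that by simp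
  then have t: "t \<in> insert Minf (Fin ` T)" "t < Fin x"
    by (auto simp: t_def A_def)
  have "Min B \<in> B" if "B \<noteq> {}"
    using fin that by simp
  then have t': "t' \<in> insert Pinf (Fin ` T)" "Fin x < t'"
    by (auto simp: t'_def B_def)
  have "sgn (x - z) = sgn (y - z)" if "t < Fin y" "Fin y < t'" "z \<in> T" for y z
  proof (cases "z < x")
    case True
    then have "z \<in> A"
      using that(3) by (simp add: A_def)
    then have "z < y"
      using that(1) fin(1) by (auto simp: t_def split: if_splits)
    then show ?thesis
      using True by simp
  next
    case False
    then have "x < z"
      using assms(2) that(3) by (cases "x = z") auto
    then have "z \<in> B"
      using that(3) by (simp add: B_def)
    then have "y < z"
      using that(2) fin(2) by (auto simp: t'_def split: if_splits)
    then show ?thesis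
      using \<open>x < z\<close> by simp
  qed
  then show thesis
    using that t t' by blast
qed

text \<open>Membership in \<open>V\<close> can change only at finitely many ordinates, so
  \<open>V\<close> is a finite union of points and open intervals, and excluding the rows of each
  takes one bend.\<close>

lemma plane_bijunctive_Compl_rows:
  assumes "plane_semilinear (UNIV \<times> V)"
  shows "plane_bijunctive (- (UNIV \<times> V))"
proof -
  obtain L where L: "finite L" "\<And>x y x' y'. \<forall>(a, b, c)\<in>L. sgn (a * x + b * y + c) = sgn (a * x' + b * y' + c)
    \<Longrightarrow> (x, y) \<in> UNIV \<times> V \<Longrightarrow> (x', y') \<in> UNIV \<times> V"
    using assms unfolding plane_semilinear_def by blast
  \<comment> \<open>The ordinates at which the lines of \<open>L\<close> meet the column
    \<open>x = 0\<close>; a set of full rows is determined by that column.\<close>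
  define Z where "Z = (\<lambda>(a, b, c). - c / b) ` L"
  have homogeneous: "y' \<in> V" if y: "\<forall>z\<in>Z. sgn (y - z) = sgn (y' - z)" "y \<in> V" for y y'
  proof -
    have "sgn (b * y + c) = sgn (b * y' + c)" if "(a, b, c) \<in> L" for a b c
    proof (cases "b = 0")
      case False
      have "- c / b \<in> Z"
        using that by (force simp: Z_def)
      then have "sgn (y - - c / b) = sgn (y' - - c / b)"
        using y(1) by blast
      moreover have "b * u + c = b * (u - - c / b)" for u
        using False by (simp add: field_simps)
      ultimately show ?thesis
        by (simp only: sgn_mult)
    qed simp
    then have "\<forall>(a, b, c)\<in>L. sgn (a * 0 + b * y + c) = sgn (a * 0 + b * y' + c)"
      by auto
    from L(2)[OF this] show ?thesis
      using y(2) by simp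
  qed
  define D where "D = {Minf, Pinf} \<union> Fin ` Z"
  define \<K> where "\<K> = (\<lambda>(r\<^sub>1, d\<^sub>1, r\<^sub>2, d\<^sub>2). (UNIV :: rat set) \<times> {y. \<not> cmp_holds r\<^sub>1 y d\<^sub>1 \<and> \<not> cmp_holds r\<^sub>2 y d\<^sub>2}) `
    ({LE, LT} \<times> D \<times> {GE, GT} \<times> D)"
  show ?thesis
  proof (rule plane_bijunctive_Compl_cover[of \<K>])
    show "finite \<K>"
      using L(1) by (simp add: \<K>_def D_def Z_def)
    show "plane_bijunctive (- A)" if A: "A \<in> \<K>" for A
    proof -
      obtain \<kappa> where \<kappa>: "A = (\<lambda>(r\<^sub>1, d\<^sub>1, r\<^sub>2, d\<^sub>2). UNIV \<times> {y. \<not> cmp_holds r\<^sub>1 y d\<^sub>1 \<and> \<not> cmp_holds r\<^sub>2 y d\<^sub>2}) \<kappa>"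
        "\<kappa> \<in> {LE, LT} \<times> D \<times> {GE, GT} \<times> D"
        using A unfolding \<K>_def by (rule imageE)
      obtain r\<^sub>1 d\<^sub>1 r\<^sub>2 d\<^sub>2 where eq: "\<kappa> = (r\<^sub>1, d\<^sub>1, r\<^sub>2, d\<^sub>2)"
        by (cases \<kappa>)
      show ?thesis
        unfolding \<kappa>(1) eq prod.case by (rule plane_bijunctive_Compl_strip) (use \<kappa>(2) eq in auto)
    qed
    fix p :: "rat \<times> rat"
    assume "p \<in> UNIV \<times> V"
    then obtain x y where p: "p = (x, y)" "y \<in> V"
      by blast
    have "\<exists>r\<^sub>1\<in>{LE, LT}. \<exists>d\<^sub>1\<in>D. \<exists>r\<^sub>2\<in>{GE, GT}. \<exists>d\<^sub>2\<in>D. \<not> cmp_holds r\<^sub>1 y d\<^sub>1 \<and> \<not> cmp_holds r\<^sub>2 y d\<^sub>2 \<and>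
      {y. \<not> cmp_holds r\<^sub>1 y d\<^sub>1 \<and> \<not> cmp_holds r\<^sub>2 y d\<^sub>2} \<subseteq> V"
    proof (cases "y \<in> Z")
      case True
      \<comment> \<open>The negations of \<open>LT\<close> and \<open>GT\<close> at the same
        endpoint leave the single row \<open>y\<close>.\<close>
      have "{y'. \<not> cmp_holds LT y' (Fin y) \<and> \<not> cmp_holds GT y' (Fin y)} \<subseteq> V"
        using p(2) by auto
      then show ?thesis
        using True by (intro bexI[of _ LT] bexI[of _ GT] bexI[of _ "Fin y"]) (auto simp: D_def)
    next
      case False
      have "finite Z"
        using L(1) by (simp add: Z_def)
      then obtain t t' where t: "t \<in> insert Minf (Fin ` Z)" "t' \<in> insert Pinf (Fin ` Z)" "t < Fin y" "Fin y < t'"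
        "\<And>y'. t < Fin y' \<Longrightarrow> Fin y' < t' \<Longrightarrow> \<forall>z\<in>Z. sgn (y - z) = sgn (y' - z)"
        using cell_bounds[of Z y] False by blast
      have "{y'. \<not> cmp_holds LE y' t \<and> \<not> cmp_holds GE y' t'} \<subseteq> V"
        using homogeneous[OF t(5) p(2)] by auto
      then show ?thesis
        using t(1-4) by (intro bexI[of _ LE] bexI[of _ GE] bexI[of _ t] bexI[of _ t']) (auto simp: D_def)
    qed
    then obtain r\<^sub>1 d\<^sub>1 r\<^sub>2 d\<^sub>2 where r: "r\<^sub>1 \<in> {LE, LT}" "d\<^sub>1 \<in> D" "r\<^sub>2 \<in> {GE, GT}" "d\<^sub>2 \<in> D"
      "\<not> cmp_holds r\<^sub>1 y d\<^sub>1 \<and> \<not> cmp_holds r\<^sub>2 y d\<^sub>2"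
      "{y. \<not> cmp_holds r\<^sub>1 y d\<^sub>1 \<and> \<not> cmp_holds r\<^sub>2 y d\<^sub>2} \<subseteq> V"
      by blast
    have "UNIV \<times> {y. \<not> cmp_holds r\<^sub>1 y d\<^sub>1 \<and> \<not> cmp_holds r\<^sub>2 y d\<^sub>2} \<in> \<K>"
      unfolding \<K>_def using r(1-4) by (intro image_eqI[of _ _ "(r\<^sub>1, d\<^sub>1, r\<^sub>2, d\<^sub>2)"]) auto
    then show "\<exists>A\<in>\<K>. p \<in> A \<and> A \<subseteq> UNIV \<times> V"
      by (rule bexI[rotated]) (use r(5,6) p(1) in auto)
  qed
qed

section \<open>Semilinear up-sets\<close>

text \<open>\<open>G\<close> holds the lines \<open>y = s x + e\<close> that can bound \<open>E\<close>; \<open>T\<close> holds the abscissae of vertical boundary lines and of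
  crossings of lines in \<open>G\<close>, so that the lines of \<open>G\<close> keep their order between consecutive points of \<open>T\<close>.\<close>

locale upset_cells =
  fixes E :: "(rat \<times> rat) set" and T :: "rat set" and G :: "(rat \<times> rat) set"
  assumes fin: "finite T" "finite G"
    and up: "(x, y) \<in> E \<Longrightarrow> x \<le> x' \<Longrightarrow> y \<le> y' \<Longrightarrow> (x', y') \<in> E"
    and mem: "\<forall>t\<in>T. sgn (x - t) = sgn (x' - t) \<Longrightarrow>
       \<forall>(s, e)\<in>G. sgn (y - (s * x + e)) = sgn (y' - (s * x' + e)) \<Longrightarrow> (x, y) \<in> E \<Longrightarrow> (x', y') \<in> E"
    and cross: "\<forall>t\<in>T. sgn (x - t) = sgn (x' - t) \<Longrightarrow> (s, e) \<in> G \<Longrightarrow> (s', e') \<in> G \<Longrightarrow>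
       sgn (s * x + e - (s' * x + e')) = sgn (s * x' + e - (s' * x' + e'))"

text \<open>Factoring out \<open>b\<close>, or \<open>a\<close> when \<open>b = 0\<close>, turns the
  sign of a linear form into a comparison with a line of \<open>G\<close> or an abscissa of
  \<open>T\<close>. Two lines of different slope exchange their order only where they cross.\<close>

lemma plane_semilinear_upset_cells:
  assumes "plane_semilinear E" and up: "\<And>x y x' y'. (x, y) \<in> E \<Longrightarrow> x \<le> x' \<Longrightarrow> y \<le> y' \<Longrightarrow> (x', y') \<in> E"
  shows "\<exists>T G. upset_cells E T G"
proof -
  obtain L where L: "finite L" "\<And>x y x' y'. \<forall>(a, b, c)\<in>L. sgn (a * x + b * y + c) = sgn (a * x' + b * y' + c)
    \<Longrightarrow> (x, y) \<in> E \<Longrightarrow> (x', y') \<in> E"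
    using assms(1) unfolding plane_semilinear_def by blast
  \<comment> \<open>Where a denominator vanishes, the junk value 0 adds a harmless superfluous line or abscissa.\<close>
  define G where "G = (\<lambda>(a, b, c). (- a / b, - c / b)) ` L"
  define T where "T = (\<lambda>(a, b, c). - c / a) ` L \<union> (\<lambda>((s, e), (s', e')). (e' - e) / (s - s')) ` (G \<times> G)"
  have fin: "finite T" "finite G"
    using L(1) by (simp_all add: T_def G_def)
  have mem: "(x', y') \<in> E" if x: "\<forall>t\<in>T. sgn (x - t) = sgn (x' - t)"
    and y: "\<forall>(s, e)\<in>G. sgn (y - (s * x + e)) = sgn (y' - (s * x' + e))" and "(x, y) \<in> E" for x y x' y'
  proof -
    have "sgn (a * x + b * y + c) = sgn (a * x' + b * y' + c)" if abc: "(a, b, c) \<in> L" for a b c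
    proof (cases "b = 0")
      case True
      have "- c / a \<in> T"
        using abc by (force simp: T_def)
      then have "sgn (x - - c / a) = sgn (x' - - c / a)"
        using x by blast
      moreover have "a * u + b * w + c = a * (u - - c / a)" if "a \<noteq> 0" for u w
        using True that by (simp add: field_simps)
      ultimately show ?thesis
        using True by (cases "a = 0") (simp, metis sgn_mult)
    next
      case False
      have "(- a / b, - c / b) \<in> G"
        using abc by (force simp: G_def)
      then have "sgn (y - (- a / b * x + - c / b)) = sgn (y' - (- a / b * x' + - c / b))"
        using y by blast
      moreover have "a * u + b * w + c = b * (w - (- a / b * u + - c / b))" for u w
        using False by (simp add: field_simps)
      ultimately show ?thesis
        by (simp only: sgn_mult)
    qed
    then have "\<forall>(a, b, c)\<in>L. sgn (a * x + b * y + c) = sgn (a * x' + b * y' + c)"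
      by blast
    from L(2)[OF this \<open>(x, y) \<in> E\<close>] show ?thesis .
  qed
  have cross: "sgn (s * x + e - (s' * x + e')) = sgn (s * x' + e - (s' * x' + e'))"
    if x: "\<forall>t\<in>T. sgn (x - t) = sgn (x' - t)" and se: "(s, e) \<in> G" "(s', e') \<in> G" for x x' s e s' e'
  proof (cases "s = s'")
    case False
    have "(e' - e) / (s - s') \<in> T"
      using se by (force simp: T_def)
    then have "sgn (x - (e' - e) / (s - s')) = sgn (x' - (e' - e) / (s - s'))"
      using x by blast
    moreover have "s * u + e - (s' * u + e') = (s - s') * (u - (e' - e) / (s - s'))" for u
      using False by (simp add: field_simps)
    ultimately show ?thesis
      by (simp only: sgn_mult)
  qed simp
  have "upset_cells E T G"
    by unfold_locales (fact fin up mem cross)+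
  then show ?thesis
    by blast
qed

context upset_cells
begin

text \<open>The line \<open>(s, e)\<close> is the highest one of \<open>G\<close> that passes weakly below the given point.\<close>

lemma column_cell:
  assumes "(x\<^sub>0, y\<^sub>0) \<in> E"
  shows "(\<forall>x y. (\<forall>t\<in>T. sgn (x\<^sub>0 - t) = sgn (x - t)) \<longrightarrow> (x, y) \<in> E) \<or>
    (\<exists>(s, e)\<in>G. \<exists>r\<in>{LE, LT}. \<not> cmp_holds r y\<^sub>0 (Fin (s * x\<^sub>0 + e)) \<and>
      (\<forall>x y. (\<forall>t\<in>T. sgn (x\<^sub>0 - t) = sgn (x - t)) \<longrightarrow> \<not> cmp_holds r y (Fin (s * x + e)) \<longrightarrow> (x, y) \<in> E))"
proof -
  define root where "root x g = fst g * x + snd g" for x and g :: "rat \<times> rat"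
  \<comment> \<open>Over every column of the cell the lines are ordered as over
    \<open>x\<^sub>0\<close>, so \<open>y\<^sub>0\<close> has a copy in the same position among
    them.\<close>
  have copy: "\<exists>y'. (\<forall>g\<in>G. sgn (y\<^sub>0 - root x\<^sub>0 g) = sgn (y' - root x g))"
    if "\<forall>t\<in>T. sgn (x\<^sub>0 - t) = sgn (x - t)" for x
    using transfer_point[OF fin(2), of "root x\<^sub>0" "root x"] cross[OF that] by (simp add: root_def)
  have mem': "(x, y) \<in> E" if "\<forall>t\<in>T. sgn (x\<^sub>0 - t) = sgn (x - t)" "\<forall>g\<in>G. sgn (y\<^sub>0 - root x\<^sub>0 g) = sgn (y - root x g)"
    for x y
    by (rule mem[OF that(1) _ assms]) (use that(2) in \<open>auto simp: root_def\<close>)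
  define H where "H = {g \<in> G. root x\<^sub>0 g \<le> y\<^sub>0}"
  have "finite H"
    using fin(2) by (simp add: H_def)
  show ?thesis
  proof (cases "H = {}")
    case True
    have "(x, y) \<in> E" if x: "\<forall>t\<in>T. sgn (x\<^sub>0 - t) = sgn (x - t)" for x y
    proof -
      obtain y' where y': "\<forall>g\<in>G. sgn (y\<^sub>0 - root x\<^sub>0 g) = sgn (y' - root x g)"
        using copy[OF x] by blast
      \<comment> \<open>All lines lie above the copy, hence also above \<open>min y y'\<close>; from
        this lower point up-closure reaches \<open>y\<close>.\<close>
      have "sgn (y\<^sub>0 - root x\<^sub>0 g) = sgn (min y y' - root x g)" if "g \<in> G" for g
      proof -
        have "g \<notin> H"
          using True by simp
        then have "y\<^sub>0 < root x\<^sub>0 g"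
          using that by (simp add: H_def not_le)
        moreover from this have "y' < root x g"
          using bspec[OF y' that] by (auto simp: sgn_if split: if_splits)
        ultimately show ?thesis
          by (simp add: sgn_if min_def)
      qed
      then have "(x, min y y') \<in> E"
        using mem'[OF x] by blast
      then show ?thesis
        by (rule up) simp_all
    qed
    then show ?thesis
      by blast
  next
    case False
    have "Max (root x\<^sub>0 ` H) \<in> root x\<^sub>0 ` H"
      using \<open>finite H\<close> False by simp
    then obtain g where g: "g \<in> H" "root x\<^sub>0 g = Max (root x\<^sub>0 ` H)"
      by force
    have g_max: "root x\<^sub>0 h \<le> root x\<^sub>0 g" if "h \<in> H" for h
      using that \<open>finite H\<close> by (simp add: g(2))
    from g(1) have gG: "g \<in> G" "root x\<^sub>0 g \<le> y\<^sub>0"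
      by (simp_all add: H_def)
    \<comment> \<open>Negated, \<open>LT\<close> includes the line itself and \<open>LE\<close>
      excludes it, according to whether the given point lies on it.\<close>
    define r where "r = (if y\<^sub>0 = root x\<^sub>0 g then LT else LE)"
    have "(x, y) \<in> E" if x: "\<forall>t\<in>T. sgn (x\<^sub>0 - t) = sgn (x - t)" and y: "\<not> cmp_holds r y (Fin (root x g))" for x y
    proof -
      obtain y' where y': "\<forall>g\<in>G. sgn (y\<^sub>0 - root x\<^sub>0 g) = sgn (y' - root x g)"
        using copy[OF x] by blast
      then have "(x, y') \<in> E"
        by (rule mem'[OF x])
      show ?thesis
      proof (cases "y' \<le> y")
        case True
        then show ?thesis
          using up[OF \<open>(x, y') \<in> E\<close>] by simp
      next
        case less: False
        have "y\<^sub>0 \<noteq> root x\<^sub>0 g"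
          using bspec[OF y' gG(1)] y less by (auto simp: r_def sgn_if split: if_splits)
        then have gt: "root x\<^sub>0 g < y\<^sub>0" "root x g < y"
          using gG(2) y by (auto simp: r_def)
        \<comment> \<open>Here \<open>y\<close> is strictly between the line \<open>g\<close> and
          the copy \<open>y'\<close>. No line of \<open>G\<close> runs there, since \<open>g\<close>
          is the highest one weakly below, so \<open>y\<close> has the same position as
          \<open>y'\<close>.\<close>
        have "sgn (y\<^sub>0 - root x\<^sub>0 h) = sgn (y - root x h)" if "h \<in> G" for h
        proof (cases "root x\<^sub>0 h \<le> y\<^sub>0")
          case True
          then have h: "root x\<^sub>0 h \<le> root x\<^sub>0 g"
            using g_max[of h] that by (simp add: H_def)
          have "sgn (root x\<^sub>0 h - root x\<^sub>0 g) = sgn (root x h - root x g)"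
            using cross[OF x, of "fst h" "snd h" "fst g" "snd g"] that gG(1) by (simp add: root_def)
          then have "root x h \<le> root x g"
            using h by (auto simp: sgn_if split: if_splits)
          then show ?thesis
            using gt h by simp
        next
          case False
          then have "y' < root x h"
            using bspec[OF y' that] by (auto simp: sgn_if split: if_splits)
          then show ?thesis
            using False less by simp
        qed
        then show ?thesis
          using mem'[OF x] by blast
      qed
    qed
    moreover have "\<not> cmp_holds r y\<^sub>0 (Fin (root x\<^sub>0 g))" "r \<in> {LE, LT}"
      using gG(2) by (auto simp: r_def)
    ultimately show ?thesis
      using gG(1) by (intro disjI2 bexI[of _ g]) (auto simp: root_def case_prod_beta)
  qed
qed

text \<open>Over the cell of its abscissa, a point of \<open>E\<close> lies in a part of
  \<open>E\<close> that is the whole cell or the region above one line. Up-closure extends this part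
  to the right, which yields a corner inside \<open>E\<close> whose parameters come from finite
  sets.\<close>

lemma corner_cover:
  obtains \<K> where "finite \<K>" "\<And>A. A \<in> \<K> \<Longrightarrow> is_corner A" "\<And>p. p \<in> E \<Longrightarrow> \<exists>A\<in>\<K>. p \<in> A \<and> A \<subseteq> E"
proof -
  \<comment> \<open>\<open>D\<^sub>1\<close> holds the left ends of cells, \<open>D\<^sub>2\<close>
    the heights of lines at ends of cells, and \<open>M\<close> the falling lines, rewritten with
    positive coefficients. The abscissa 0 provides the height of a horizontal line even when
    \<open>T\<close> is empty.\<close>
  define D\<^sub>1 where "D\<^sub>1 = insert Minf (Fin ` T)"
  define D\<^sub>2 where "D\<^sub>2 = insert Minf ((\<lambda>((s, e), t). Fin (s * t + e)) ` (G \<times> insert 0 T))"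
  define M where "M = insert (1, Minf) ((\<lambda>(s, e). (- s, Fin e)) ` {(s, e) \<in> G. s < 0})"
  define \<K> where "\<K> = (\<lambda>(r\<^sub>1, d\<^sub>1, r, (a, c), r\<^sub>2, d\<^sub>2). corner r\<^sub>1 d\<^sub>1 r a 1 c r\<^sub>2 d\<^sub>2) `
    ({LE, LT} \<times> D\<^sub>1 \<times> {LE, LT} \<times> M \<times> {LE, LT} \<times> D\<^sub>2)"
  have \<K>I: "corner r\<^sub>1 d\<^sub>1 r a 1 c r\<^sub>2 d\<^sub>2 \<in> \<K>"
    if "r\<^sub>1 \<in> {LE, LT}" "d\<^sub>1 \<in> D\<^sub>1" "r \<in> {LE, LT}" "(a, c) \<in> M" "r\<^sub>2 \<in> {LE, LT}" "d\<^sub>2 \<in> D\<^sub>2" for r\<^sub>1 d\<^sub>1 r a c r\<^sub>2 d\<^sub>2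
    unfolding \<K>_def using that by (intro image_eqI[of _ _ "(r\<^sub>1, d\<^sub>1, r, (a, c), r\<^sub>2, d\<^sub>2)"]) auto
  have triv: "(1, Minf) \<in> M" "Minf \<in> D\<^sub>2"
    by (simp_all add: M_def D\<^sub>2_def)
  have "finite \<K>"
    using fin by (auto simp: \<K>_def D\<^sub>1_def D\<^sub>2_def M_def intro!: finite_imageI finite_cartesian_product
        intro: finite_subset[of _ G])
  moreover have "is_corner A" if "A \<in> \<K>" for A
  proof -
    obtain \<kappa> where \<kappa>: "A = (\<lambda>(r\<^sub>1, d\<^sub>1, r, (a, c), r\<^sub>2, d\<^sub>2). corner r\<^sub>1 d\<^sub>1 r a 1 c r\<^sub>2 d\<^sub>2) \<kappa>"
      "\<kappa> \<in> {LE, LT} \<times> D\<^sub>1 \<times> {LE, LT} \<times> M \<times> {LE, LT} \<times> D\<^sub>2"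
      using \<open>A \<in> \<K>\<close> unfolding \<K>_def by (rule imageE)
    obtain r\<^sub>1 d\<^sub>1 r a c r\<^sub>2 d\<^sub>2 where eq: "\<kappa> = (r\<^sub>1, d\<^sub>1, r, (a, c), r\<^sub>2, d\<^sub>2)"
      by (metis surj_pair)
    have "a > 0"
      using \<kappa>(2) eq by (auto simp: M_def)
    then show ?thesis
      unfolding \<kappa>(1) eq prod.case by (intro is_cornerI) (use \<kappa>(2) eq in auto)
  qed
  moreover have "\<exists>A\<in>\<K>. p \<in> A \<and> A \<subseteq> E" if p: "p \<in> E" for p
  proof -
    obtain x\<^sub>0 y\<^sub>0 where p0: "p = (x\<^sub>0, y\<^sub>0)" "(x\<^sub>0, y\<^sub>0) \<in> E"
      using p by (cases p) auto
    let ?cell = "\<lambda>x. \<forall>t\<in>T. sgn (x\<^sub>0 - t) = sgn (x - t)"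
    consider (all) "\<And>x y. ?cell x \<Longrightarrow> (x, y) \<in> E"
      | (root) s e r where "(s, e) \<in> G" "r \<in> {LE, LT}" "\<not> cmp_holds r y\<^sub>0 (Fin (s * x\<^sub>0 + e))"
        "\<And>x y. ?cell x \<Longrightarrow> \<not> cmp_holds r y (Fin (s * x + e)) \<Longrightarrow> (x, y) \<in> E"
      using column_cell[OF p0(2)] by blast
    note cell_cases = this
    show ?thesis
    proof (cases "x\<^sub>0 \<in> T")
      \<comment> \<open>The cell is the single column at \<open>x\<^sub>0\<close>, and the corner is
        obtained by moving it to the right.\<close>
      case True
      then have x\<^sub>0: "Fin x\<^sub>0 \<in> D\<^sub>1"
        by (simp add: D\<^sub>1_def)
      show ?thesis
      proof (cases rule: cell_cases)
        case all
        have "(x, y) \<in> E" if "x\<^sub>0 \<le> x" for x y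
          using up[OF all[of x\<^sub>0 y]] that by simp
        then have "corner LT (Fin x\<^sub>0) LE 1 1 Minf LE Minf \<subseteq> E"
          by (auto simp: corner_def)
        moreover have "p \<in> corner LT (Fin x\<^sub>0) LE 1 1 Minf LE Minf"
          by (simp add: corner_def p0(1))
        ultimately show ?thesis
          using \<K>I[of LT "Fin x\<^sub>0" LE 1 Minf LE Minf] x\<^sub>0 triv by blast
      next
        case (root s e r)
        have "(x, y) \<in> E" if "x\<^sub>0 \<le> x" "\<not> cmp_holds r y (Fin (s * x\<^sub>0 + e))" for x y
          using up[OF root(4)[of x\<^sub>0 y]] that by simp
        then have "corner LT (Fin x\<^sub>0) LE 1 1 Minf r (Fin (s * x\<^sub>0 + e)) \<subseteq> E"
          by (auto simp: corner_def)
        moreover have "p \<in> corner LT (Fin x\<^sub>0) LE 1 1 Minf r (Fin (s * x\<^sub>0 + e))"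
          using root(3) by (simp add: corner_def p0(1))
        moreover have "Fin (s * x\<^sub>0 + e) \<in> D\<^sub>2"
          using root(1) True by (force simp: D\<^sub>2_def)
        ultimately show ?thesis
          using \<K>I[of LT "Fin x\<^sub>0" LE 1 Minf r "Fin (s * x\<^sub>0 + e)"] x\<^sub>0 triv root(2) by blast
      qed
    next
      case False
      obtain t t' where t: "t \<in> D\<^sub>1" "t' \<in> insert Pinf (Fin ` T)" "t < Fin x\<^sub>0" "Fin x\<^sub>0 < t'"
        "\<And>x. t < Fin x \<Longrightarrow> Fin x < t' \<Longrightarrow> ?cell x"
        unfolding D\<^sub>1_def using cell_bounds[OF fin(1) False] by blast
      \<comment> \<open>The cell is open at \<open>t\<close>, so it contains abscissae to the left
        of any \<open>x\<close> and \<open>q\<close> beyond \<open>t\<close>; up-closure then leads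
        from such a column back to \<open>x\<close>.\<close>
      have below: "\<exists>x'\<le>x. t < Fin x' \<and> Fin x' < t' \<and> x' < q" if "t < Fin x" "t < Fin q" for x q
      proof (cases t)
        case (Fin u)
        then have "u < min x (min x\<^sub>0 q)"
          using that t(3) by simp
        then obtain x' where "u < x'" "x' < min x (min x\<^sub>0 q)"
          using dense by blast
        moreover from this have "Fin x' < t'"
          using t(4) by (cases t') auto
        ultimately show ?thesis
          using Fin by (intro exI[of _ x']) auto
      next
        case Minf
        have "Fin (min x (min x\<^sub>0 q) - 1) < t'"
          using t(4) by (cases t') auto
        then show ?thesis
          using Minf by (intro exI[of _ "min x (min x\<^sub>0 q) - 1"]) auto
      qed (use t(3) in simp)
      show ?thesis
      proof (cases rule: cell_cases)
        case all
        have "(x, y) \<in> E" if "t < Fin x" for x y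
          using below[OF that t(3)] all t(5) up by blast
        then have "corner LE t LE 1 1 Minf LE Minf \<subseteq> E"
          by (auto simp: corner_def not_le)
        moreover have "p \<in> corner LE t LE 1 1 Minf LE Minf"
          using t(3) by (simp add: corner_def p0(1) not_le)
        ultimately show ?thesis
          using \<K>I[of LE t LE 1 Minf LE Minf] t(1) triv by blast
      next
        case (root s e r)
        \<comment> \<open>Above a rising segment the up-set contains the whole quadrant at its left end; above a falling
          segment the line must be cut off at the height of its right end.\<close>
        consider "s = 0" | "s > 0" | "s < 0"
          by linarith
        then show ?thesis
        proof cases
          case 1
          have "(x, y) \<in> E" if xy: "t < Fin x" "\<not> cmp_holds r y (Fin e)" for x y
          proof -
            obtain x' where "x' \<le> x" "t < Fin x'" "Fin x' < t'"
              using below[OF xy(1) t(3)] by blast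
            then show ?thesis
              using up[OF root(4)[OF t(5)]] xy(2) 1 by simp
          qed
          then have "corner LE t LE 1 1 Minf r (Fin e) \<subseteq> E"
            by (auto simp: corner_def not_le)
          moreover have "p \<in> corner LE t LE 1 1 Minf r (Fin e)"
            using t(3) root(3) 1 by (simp add: corner_def p0(1) not_le)
          moreover have "Fin e \<in> D\<^sub>2"
            using root(1) by (force simp: D\<^sub>2_def)
          ultimately show ?thesis
            using \<K>I[of LE t LE 1 Minf r "Fin e"] t(1) triv root(2) by blast
        next
          case 2
          \<comment> \<open>The height of the rising line at the left end. Any \<open>y\<close>
            above it is above the line at abscissae close enough to \<open>t\<close>; with
            \<open>t\<close> infinite the line drops below every height.\<close>
          define d where "d = (case t of Fin u \<Rightarrow> Fin (s * u + e) | _ \<Rightarrow> Minf)"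
          have "d \<in> D\<^sub>2"
            using t(1) root(1) by (force simp: d_def D\<^sub>2_def D\<^sub>1_def split: extended.split)
          have "(x, y) \<in> E" if xy: "t < Fin x" "d < Fin y" for x y
          proof -
            have "t < Fin ((y - e) / s)"
              using xy(2) 2 t(3) by (cases t) (auto simp: d_def field_simps)
            then obtain x' where x': "x' \<le> x" "t < Fin x'" "Fin x' < t'" "x' < (y - e) / s"
              using below[OF xy(1)] by blast
            then have "\<not> cmp_holds r y (Fin (s * x' + e))"
              using 2 root(2) by (auto simp: field_simps)
            then show ?thesis
              using up[OF root(4)[OF t(5)[OF x'(2,3)]]] x'(1) by simp
          qed
          then have "corner LE t LE 1 1 Minf LE d \<subseteq> E"
            by (auto simp: corner_def not_le)
          moreover have "d < Fin y\<^sub>0"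
          proof (cases t)
            case (Fin u)
            then have "s * u < s * x\<^sub>0"
              using t(3) 2 by simp
            moreover have "s * x\<^sub>0 + e \<le> y\<^sub>0"
              using root(2,3) by auto
            ultimately show ?thesis
              using Fin by (simp add: d_def)
          qed (simp_all add: d_def)
          then have "p \<in> corner LE t LE 1 1 Minf LE d"
            using t(3) by (simp add: corner_def p0(1) not_le)
          ultimately show ?thesis
            using \<K>I[of LE t LE 1 Minf LE d] t(1) triv \<open>d \<in> D\<^sub>2\<close> by blast
        next
          case 3
          define d where "d = (case t' of Fin u \<Rightarrow> Fin (s * u + e) | _ \<Rightarrow> Minf)"
          have line: "cmp_holds r (- s * x + 1 * y) (Fin e) = cmp_holds r y (Fin (s * x + e))" for x y
            using root(2) by (auto simp: algebra_simps)
          have "d \<in> D\<^sub>2"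
            using t(2) root(1) by (force simp: d_def D\<^sub>2_def split: extended.split)
          have "(- s, Fin e) \<in> M"
            using root(1) 3 by (force simp: M_def)
          have "(x, y) \<in> E" if xy: "t < Fin x" "d < Fin y" "\<not> cmp_holds r y (Fin (s * x + e))" for x y
          proof (cases "Fin x < t'")
            case True
            then show ?thesis
              using root(4)[OF t(5)] xy by blast
          next
            \<comment> \<open>Beyond the right end \<open>u\<close>, the condition
              \<open>d < y\<close> means that the line drops below height \<open>y\<close> before
              \<open>u\<close>. Some \<open>x'\<close> in the cell past that crossing gives
              \<open>(x', y)\<close> in \<open>E\<close>; taking it beyond \<open>x\<^sub>0\<close>
              keeps it right of \<open>t\<close>.\<close>
            case False
            then obtain u where u: "t' = Fin u" "u \<le> x"
              using t(4) by (cases t') auto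
            have "(y - e) / s < u"
              using xy(2) 3 u(1) by (simp add: d_def field_simps)
            then have "max x\<^sub>0 ((y - e) / s) < u"
              using t(4) u(1) by simp
            then obtain x' where x': "max x\<^sub>0 ((y - e) / s) < x'" "x' < u"
              using dense by blast
            then have "\<not> cmp_holds r y (Fin (s * x' + e))"
              using 3 root(2) by (auto simp: field_simps)
            moreover have "t < Fin x'"
              using x'(1) by (intro less_trans[OF t(3)]) simp
            ultimately have "(x', y) \<in> E"
              using root(4)[OF t(5)] x'(2) u(1) by simp
            then show ?thesis
              by (rule up) (use x'(2) u(2) in auto)
          qed
          then have "corner LE t r (- s) 1 (Fin e) LE d \<subseteq> E"
            unfolding corner_def line by (auto simp: not_le)
          moreover have "d < Fin y\<^sub>0"
          proof (cases t')
            case (Fin u)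
            then have "s * u < s * x\<^sub>0"
              using t(4) 3 by simp
            moreover have "s * x\<^sub>0 + e \<le> y\<^sub>0"
              using root(2,3) by auto
            ultimately show ?thesis
              using Fin by (simp add: d_def)
          qed (simp_all add: d_def)
          then have "p \<in> corner LE t r (- s) 1 (Fin e) LE d"
            unfolding corner_def line using t(3) root(3) by (simp add: p0(1) not_le)
          ultimately show ?thesis
            using \<K>I[of LE t r "- s" "Fin e" LE d] t(1) \<open>(- s, Fin e) \<in> M\<close> root(2) \<open>d \<in> D\<^sub>2\<close> by blast
        qed
      qed
    qed
  qed
  ultimately show thesis
    by (rule that)
qed

end

lemma plane_bijunctive_Compl_upset:
  assumes "plane_semilinear E" "\<And>x y x' y'. (x, y) \<in> E \<Longrightarrow> x \<le> x' \<Longrightarrow> y \<le> y' \<Longrightarrow> (x', y') \<in> E"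
    and "\<sigma> \<in> {1, -1}" "\<tau> \<in> {1, -1}"
  shows "plane_bijunctive (- reflect \<sigma> \<tau> E)"
proof -
  obtain T G where "upset_cells E T G"
    using plane_semilinear_upset_cells[OF assms(1)] assms(2) by blast
  then obtain \<K> where \<K>: "finite \<K>" "\<And>A. A \<in> \<K> \<Longrightarrow> is_corner A" "\<And>p. p \<in> E \<Longrightarrow> \<exists>A\<in>\<K>. p \<in> A \<and> A \<subseteq> E"
    by (rule upset_cells.corner_cover) blast
  show ?thesis
  proof (rule plane_bijunctive_Compl_cover[of "reflect \<sigma> \<tau> ` \<K>"])
    show "plane_bijunctive (- A)" if "A \<in> reflect \<sigma> \<tau> ` \<K>" for A
      using that plane_bijunctive_Compl_reflect_corner \<K>(2) assms(3,4) by blast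
    fix p
    assume "p \<in> reflect \<sigma> \<tau> E"
    then have "(\<sigma> * fst p, \<tau> * snd p) \<in> E"
      by (auto simp: reflect_def)
    then obtain A where A: "A \<in> \<K>" "(\<sigma> * fst p, \<tau> * snd p) \<in> A" "A \<subseteq> E"
      using \<K>(3) by blast
    then have "p \<in> reflect \<sigma> \<tau> A" "reflect \<sigma> \<tau> A \<subseteq> reflect \<sigma> \<tau> E"
      by (auto simp: reflect_def)
    then show "\<exists>A\<in>reflect \<sigma> \<tau> ` \<K>. p \<in> A \<and> A \<subseteq> reflect \<sigma> \<tau> E"
      using A(1) by blast
  qed (use \<K>(1) in simp)
qed

section \<open>Median-closed relations\<close>

definition median_closed :: "(rat \<times> rat) set \<Rightarrow> bool" where
  "median_closed S \<longleftrightarrow> (\<forall>x y x' y' x'' y''. (x, y) \<in> S \<longrightarrow> (x', y') \<in> S \<longrightarrow> (x'', y'') \<in> S \<longrightarrow>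
     (median x x' x'', median y y' y'') \<in> S)"

lemma median_between:
  "x \<le> y \<Longrightarrow> y \<le> z \<Longrightarrow> median x y z = y" "x \<le> y \<Longrightarrow> y \<le> z \<Longrightarrow> median y x z = y"
  "x \<le> y \<Longrightarrow> y \<le> z \<Longrightarrow> median y z x = y" "x \<le> y \<Longrightarrow> y \<le> z \<Longrightarrow> median z y x = y"
  by (auto simp: median_max_min max_def min_def)

text \<open>If neither the row nor the column at \<open>(x, y)\<close> misses \<open>S\<close>, they
  contain points \<open>(u, y)\<close> and \<open>(x, w)\<close> of \<open>S\<close>. A third point
  of \<open>S\<close> in the quadrant facing away from \<open>u\<close> and \<open>w\<close> makes
  \<open>(x, y)\<close> the median of the three.\<close>

lemma median_closed_decomposition:
  assumes "median_closed S"
  shows "S = (\<Inter>\<sigma>\<in>{1, -1}. \<Inter>\<tau>\<in>{1, -1}. - reflect \<sigma> \<tau> (quadrant_free (reflect \<sigma> \<tau> S))) \<inter>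
    - row_free S \<inter> - (prod.swap -` row_free (prod.swap -` S))" (is "_ = ?Q \<inter> ?H \<inter> ?V")
proof
  have "(x, y) \<notin> reflect \<sigma> \<tau> (quadrant_free (reflect \<sigma> \<tau> S))"
    if "(x, y) \<in> S" "\<sigma> \<in> {1, -1}" "\<tau> \<in> {1, -1}" for x y \<sigma> \<tau>
  proof -
    have "\<sigma> * (\<sigma> * x) = x" "\<tau> * (\<tau> * y) = y"
      using that(2,3) by auto
    then have "\<exists>x'\<ge>\<sigma> * x. \<exists>y'\<ge>\<tau> * y. (\<sigma> * x', \<tau> * y') \<in> S"
      using that(1) by (metis order_refl)
    then show ?thesis
      by (auto simp: reflect_def quadrant_free_def)
  qed
  then have "S \<subseteq> ?Q"
    by (intro subsetI INT_I) (metis ComplI surj_pair)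
  moreover have "S \<subseteq> ?H \<inter> ?V"
    by (auto simp: row_free_def)
  ultimately show "S \<subseteq> ?Q \<inter> ?H \<inter> ?V"
    by blast
  show "?Q \<inter> ?H \<inter> ?V \<subseteq> S"
  proof clarify
    fix x y
    assume Q: "(x, y) \<in> ?Q" and H: "(x, y) \<notin> row_free S" and V: "(x, y) \<notin> prod.swap -` row_free (prod.swap -` S)"
    obtain u where u: "(u, y) \<in> S"
      using H by (auto simp: row_free_def)
    obtain w where w: "(x, w) \<in> S"
      using V by (auto simp: row_free_def)
    \<comment> \<open>The signs select the quadrant for which \<open>x\<close> lies between
      \<open>u\<close> and the third abscissa and \<open>y\<close> between \<open>w\<close> and the
      third ordinate.\<close>
    define \<sigma> :: rat where "\<sigma> = (if x \<le> u then -1 else 1)"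
    define \<tau> :: rat where "\<tau> = (if y \<le> w then -1 else 1)"
    have "(x, y) \<notin> reflect \<sigma> \<tau> (quadrant_free (reflect \<sigma> \<tau> S))"
      using Q by (auto simp: \<sigma>_def \<tau>_def)
    then obtain x' y' where p: "\<sigma> * x \<le> x'" "\<tau> * y \<le> y'" "(\<sigma> * x', \<tau> * y') \<in> S"
      by (auto simp: reflect_def quadrant_free_def)
    have "median u x (\<sigma> * x') = x"
      using p(1) by (cases "x \<le> u") (auto simp: \<sigma>_def intro: median_between)
    moreover have "median y w (\<tau> * y') = y"
      using p(2) by (cases "y \<le> w") (auto simp: \<tau>_def intro: median_between)
    ultimately show "(x, y) \<in> S"
      using assms[unfolded median_closed_def, rule_format, OF u w p(3)] by simp
  qed
qed

lemma plane_bijunctive_median_closed: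
  assumes "plane_semilinear S" "median_closed S"
  shows "plane_bijunctive S"
proof -
  have row: "plane_bijunctive (- row_free S')" if "plane_semilinear S'" for S'
  proof -
    have "row_free S' = UNIV \<times> {y. \<forall>x. (x, y) \<notin> S'}"
      by (auto simp: row_free_def)
    then show ?thesis
      using plane_bijunctive_Compl_rows plane_semilinear_row_free[OF that] by metis
  qed
  define Q where "Q = (\<lambda>(\<sigma>, \<tau>). - reflect \<sigma> \<tau> (quadrant_free (reflect \<sigma> \<tau> S))) ` ({1, -1} \<times> {1, -1})"
  define \<A> where "\<A> = Q \<union> {- row_free S, prod.swap -` (- row_free (prod.swap -` S))}"
  have quadrant: "plane_bijunctive (- reflect \<sigma> \<tau> (quadrant_free (reflect \<sigma> \<tau> S)))"
    if "\<sigma> \<in> {1, -1}" "\<tau> \<in> {1, -1}" for \<sigma> \<tau>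
  proof (rule plane_bijunctive_Compl_upset[OF _ _ that])
    show "plane_semilinear (quadrant_free (reflect \<sigma> \<tau> S))"
      by (intro plane_semilinear_quadrant_free plane_semilinear_reflect assms(1))
    show "(x', y') \<in> quadrant_free (reflect \<sigma> \<tau> S)"
      if "(x, y) \<in> quadrant_free (reflect \<sigma> \<tau> S)" "x \<le> x'" "y \<le> y'" for x y x' y'
      using that by (auto simp: quadrant_free_def)
  qed
  have "plane_bijunctive (\<Inter>\<A>)"
  proof (rule plane_bijunctive_Inter)
    show "finite \<A>"
      by (simp add: \<A>_def Q_def)
    fix A
    assume "A \<in> \<A>"
    then consider "A \<in> Q" | "A = - row_free S" | "A = prod.swap -` (- row_free (prod.swap -` S))"
      unfolding \<A>_def by blast
    then show "plane_bijunctive A"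
    proof cases
      case 1
      then show ?thesis
        unfolding Q_def using quadrant by auto
    next
      case 2
      then show ?thesis
        using row[OF assms(1)] by simp
    next
      case 3
      then show ?thesis
        using plane_bijunctive_swap[OF row[OF plane_semilinear_swap[OF assms(1)]]] by simp
    qed
  qed
  moreover have "\<Inter>\<A> = S"
    by (rule trans[OF _ median_closed_decomposition[OF assms(2), symmetric]]) (auto simp: \<A>_def Q_def)
  ultimately show ?thesis
    by simp
qed

section \<open>Reconstruction from binary projections\<close>

lemma median_closed_proj2:
  assumes "preserves median k R" "i < k" "j < k"
  shows "median_closed (proj2 i j R)"
  unfolding median_closed_def
proof (intro allI impI)
  fix x y x' y' x'' y''
  assume "(x, y) \<in> proj2 i j R" "(x', y') \<in> proj2 i j R" "(x'', y'') \<in> proj2 i j R"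
  then obtain xs ys zs where R: "xs \<in> R" "ys \<in> R" "zs \<in> R"
    and eq: "x = xs ! i" "y = xs ! j" "x' = ys ! i" "y' = ys ! j" "x'' = zs ! i" "y'' = zs ! j"
    unfolding proj2_def by blast
  have "map (\<lambda>i. median (xs ! i) (ys ! i) (zs ! i)) [0..<k] \<in> R"
    using assms(1) R unfolding preserves_def by blast
  then show "(median x x' x'', median y y' y'') \<in> proj2 i j R"
    unfolding proj2_def by (rule rev_image_eqI) (use assms(2,3) eq in simp)
qed

text \<open>The Baker--Pixley argument: of three tuples each missing a different coordinate of \<open>I\<close>, at least two are
  correct at every coordinate of \<open>I\<close>, so their median is correct on all of \<open>I\<close>.\<close>

lemma median_preserved_2_decomposable:
  assumes "preserves median k R" "R \<subseteq> tuples k" "xs \<in> tuples k" "0 < k"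
    and pairs: "\<And>i j. i < k \<Longrightarrow> j < k \<Longrightarrow> (xs ! i, xs ! j) \<in> proj2 i j R"
  shows "xs \<in> R"
proof -
  \<comment> \<open>The induction is on the set of coordinates to be matched; sets with at most two
    elements are served by the binary projections.\<close>
  have "\<exists>t\<in>R. \<forall>i\<in>I. t ! i = xs ! i" if "I \<subseteq> {..<k}" for I
  proof -
    have "finite I"
      using that finite_subset by blast
    then show ?thesis
      using that
    proof (induction I rule: finite_psubset_induct)
      case (psubset I)
      show ?case
      proof (cases "\<exists>a\<in>I. \<exists>b\<in>I. \<exists>c\<in>I. a \<noteq> b \<and> a \<noteq> c \<and> b \<noteq> c")
        case True
        then obtain a b c where abc: "a \<in> I" "b \<in> I" "c \<in> I" "a \<noteq> b" "a \<noteq> c" "b \<noteq> c"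
          by blast
        have IH: "\<exists>t\<in>R. \<forall>i\<in>I - {d}. t ! i = xs ! i" if "d \<in> I" for d
          using psubset.IH[of "I - {d}"] psubset.prems that by blast
        obtain ta where ta: "ta \<in> R" "\<forall>i\<in>I - {a}. ta ! i = xs ! i"
          using IH[OF abc(1)] by blast
        obtain tb where tb: "tb \<in> R" "\<forall>i\<in>I - {b}. tb ! i = xs ! i"
          using IH[OF abc(2)] by blast
        obtain tc where tc: "tc \<in> R" "\<forall>i\<in>I - {c}. tc ! i = xs ! i"
          using IH[OF abc(3)] by blast
        define m where "m = map (\<lambda>i. median (ta ! i) (tb ! i) (tc ! i)) [0..<k]"
        have "m \<in> R"
          using assms(1) ta(1) tb(1) tc(1) unfolding preserves_def m_def by blast
        moreover have "m ! i = xs ! i" if i: "i \<in> I" for i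
        proof -
          have m_i: "m ! i = median (ta ! i) (tb ! i) (tc ! i)"
            using psubset.prems i by (auto simp: m_def)
          consider "i \<noteq> a" "i \<noteq> b" | "i \<noteq> a" "i \<noteq> c" | "i \<noteq> b" "i \<noteq> c"
            using abc(4-6) by blast
          then show ?thesis
            using ta(2) tb(2) tc(2) i by cases (simp_all add: m_i median_agree)
        qed
        ultimately show ?thesis
          by blast
      next
        case False
        have "\<exists>a<k. \<exists>b<k. I \<subseteq> {a, b}"
        proof (cases "\<exists>a\<in>I. \<exists>b\<in>I. a \<noteq> b")
          case True
          then obtain a b where "a \<in> I" "b \<in> I" "a \<noteq> b"
            by blast
          moreover from this have "I \<subseteq> {a, b}"
            using False by blast
          ultimately show ?thesis
            using psubset.prems by blast
        next
          case False
          \<comment> \<open>A singleton uses its element twice; for the empty set, coordinate 0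
            serves, which exists since \<open>0 < k\<close>.\<close>
          then have "I = {} \<or> (\<exists>a. I = {a})"
            by blast
          then show ?thesis
            using psubset.prems \<open>0 < k\<close> by auto
        qed
        then obtain a b where ab: "a < k" "b < k" "I \<subseteq> {a, b}"
          by blast
        obtain t where "t \<in> R" "xs ! a = t ! a" "xs ! b = t ! b"
          using pairs[OF ab(1,2)] unfolding proj2_def by auto
        then show ?thesis
          using ab(3) by (intro bexI[of _ t]) auto
      qed
    qed
  qed
  from this[OF subset_refl] obtain t where "t \<in> R" "\<forall>i\<in>{..<k}. t ! i = xs ! i"
    by blast
  moreover from this have "t = xs"
    using assms(2,3) by (intro nth_equalityI) (auto simp: tuples_def)
  ultimately show ?thesis
    by simp
qed

lemma preserves_median_bijunctive_definable:
  assumes "k \<ge> 1" "R \<subseteq> tuples k" "semilinear k R" "preserves median k R"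
  shows "bijunctive_definable k R"
proof -
  have "\<forall>p\<in>{..<k} \<times> {..<k}. \<exists>F. bijunctive F \<and> (\<forall>B\<in>F. \<forall>l\<in>B. lit_vars l \<subseteq> {fst p, snd p}) \<and>
    (\<forall>v. (v (fst p), v (snd p)) \<in> proj2 (fst p) (snd p) R \<longleftrightarrow> (\<forall>B\<in>F. \<exists>l\<in>B. lit_sat v l))"
  proof
    fix p
    assume p: "p \<in> {..<k} \<times> {..<k}"
    then have "plane_bijunctive (proj2 (fst p) (snd p) R)"
      using assms by (intro plane_bijunctive_median_closed plane_semilinear_proj2 median_closed_proj2) auto
    then show "\<exists>F. bijunctive F \<and> (\<forall>B\<in>F. \<forall>l\<in>B. lit_vars l \<subseteq> {fst p, snd p}) \<and>
      (\<forall>v. (v (fst p), v (snd p)) \<in> proj2 (fst p) (snd p) R \<longleftrightarrow> (\<forall>B\<in>F. \<exists>l\<in>B. lit_sat v l))"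
      unfolding plane_bijunctive_def by (elim allE)
  qed
  then obtain F where F: "\<forall>p\<in>{..<k} \<times> {..<k}. bijunctive (F p) \<and>
    (\<forall>B\<in>F p. \<forall>l\<in>B. lit_vars l \<subseteq> {fst p, snd p}) \<and>
    (\<forall>v. (v (fst p), v (snd p)) \<in> proj2 (fst p) (snd p) R \<longleftrightarrow> (\<forall>B\<in>F p. \<exists>l\<in>B. lit_sat v l))"
    unfolding bchoice_iff by (elim exE)
  let ?F = "\<Union>(F ` ({..<k} \<times> {..<k}))"
  have "bijunctive ?F"
    using F by (auto simp: bijunctive_def)
  moreover have "\<forall>B\<in>?F. \<forall>l\<in>B. lit_vars l \<subseteq> {..<k}"
  proof (intro ballI)
    fix B l
    assume "B \<in> ?F" "l \<in> B"
    then obtain p where p: "p \<in> {..<k} \<times> {..<k}" "B \<in> F p"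
      by blast
    then have "lit_vars l \<subseteq> {fst p, snd p}"
      using F \<open>l \<in> B\<close> by blast
    also have "\<dots> \<subseteq> {..<k}"
      using p(1) by auto
    finally show "lit_vars l \<subseteq> {..<k}" .
  qed
  moreover have "R = {xs \<in> tuples k. \<forall>B\<in>?F. \<exists>l\<in>B. lit_sat ((!) xs) l}"
  proof -
    have sat: "(\<forall>B\<in>?F. \<exists>l\<in>B. lit_sat ((!) xs) l) \<longleftrightarrow>
        (\<forall>p\<in>{..<k} \<times> {..<k}. (xs ! fst p, xs ! snd p) \<in> proj2 (fst p) (snd p) R)" for xs
      using F by simp
    have "xs \<in> R \<longleftrightarrow> xs \<in> tuples k \<and> (\<forall>p\<in>{..<k} \<times> {..<k}. (xs ! fst p, xs ! snd p) \<in> proj2 (fst p) (snd p) R)" for xs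
    proof
      assume "xs \<in> R"
      then show "xs \<in> tuples k \<and> (\<forall>p\<in>{..<k} \<times> {..<k}. (xs ! fst p, xs ! snd p) \<in> proj2 (fst p) (snd p) R)"
        using assms(2) by (auto simp: proj2_def)
    next
      assume xs: "xs \<in> tuples k \<and> (\<forall>p\<in>{..<k} \<times> {..<k}. (xs ! fst p, xs ! snd p) \<in> proj2 (fst p) (snd p) R)"
      show "xs \<in> R"
        by (rule median_preserved_2_decomposable[OF assms(4,2)]) (use xs assms(1) in auto)
    qed
    then show ?thesis
      unfolding sat by blast
  qed
  ultimately show ?thesis
    unfolding bijunctive_definable_def by blast
qed

section \<open>The quadrant property\<close>

lemma cmp_holds_down: "r \<in> {LE, LT} \<Longrightarrow> cmp_holds r q d \<Longrightarrow> q' \<le> q \<Longrightarrow> cmp_holds r q' d"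
  by (cases d) auto

lemma cmp_holds_up: "r \<notin> {LE, LT} \<Longrightarrow> cmp_holds r q d \<Longrightarrow> q \<le> q' \<Longrightarrow> cmp_holds r q' d"
  by (cases r; cases d) auto

text \<open>Outside the bend all present disjuncts fail, and they keep failing when \<open>u\<close>
  and \<open>v\<close> move so that \<open>a\<^sub>1 * u\<close> and \<open>a\<^sub>2 * v\<close>
  grow: the sign coupling makes the bounds fail in the same direction. The signs thus name the
  quadrant. The flags \<open>P\<^sub>1\<close>, \<open>P\<close>, \<open>P\<^sub>2\<close> record
  which disjuncts are present.\<close>

lemma quadrant_property_bend:
  assumes "r \<in> {LE, LT}" "a\<^sub>1 \<noteq> 0" "a\<^sub>2 \<noteq> 0" "r\<^sub>1 \<in> {LE, LT} \<longleftrightarrow> a\<^sub>1 > 0" "r\<^sub>2 \<in> {LE, LT} \<longleftrightarrow> a\<^sub>2 > 0"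
  shows "quadrant_property {(u, v). P\<^sub>1 \<and> cmp_holds r\<^sub>1 u d\<^sub>1 \<or> P \<and> cmp_holds r (a\<^sub>1 * u + a\<^sub>2 * v) c \<or>
    P\<^sub>2 \<and> cmp_holds r\<^sub>2 v d\<^sub>2}" (is "quadrant_property ?S")
  unfolding quadrant_property_def
proof (intro allI impI)
  fix u v
  assume uv: "(u, v) \<in> - ?S"
  have move: "(u', v') \<in> - ?S"
    if "if a\<^sub>1 > 0 then u \<le> u' else u' \<le> u" "if a\<^sub>2 > 0 then v \<le> v' else v' \<le> v" for u' v'
  proof -
    have "a\<^sub>1 * u \<le> a\<^sub>1 * u'" "a\<^sub>2 * v \<le> a\<^sub>2 * v'"
      using that assms(2,3) by (auto simp: mult_le_cancel_left split: if_splits)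
    then have "cmp_holds r (a\<^sub>1 * u' + a\<^sub>2 * v') c \<Longrightarrow> cmp_holds r (a\<^sub>1 * u + a\<^sub>2 * v) c"
      using cmp_holds_down[OF assms(1)] add_mono by blast
    moreover have "cmp_holds r\<^sub>1 u' d\<^sub>1 \<Longrightarrow> cmp_holds r\<^sub>1 u d\<^sub>1"
      using that(1) assms(4) cmp_holds_down cmp_holds_up by (cases "a\<^sub>1 > 0") auto
    moreover have "cmp_holds r\<^sub>2 v' d\<^sub>2 \<Longrightarrow> cmp_holds r\<^sub>2 v d\<^sub>2"
      using that(2) assms(5) cmp_holds_down cmp_holds_up by (cases "a\<^sub>2 > 0") auto
    ultimately show ?thesis
      using uv by auto
  qed
  have "{(u', v') | u' v'. (if a\<^sub>1 > 0 then u \<le> u' else u' \<le> u) \<and> (if a\<^sub>2 > 0 then v \<le> v' else v' \<le> v)} \<subseteq> - ?S"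
    using move by blast
  then show "{(u', v') | u' v'. u' \<ge> u \<and> v' \<ge> v} \<subseteq> - ?S \<or> {(u', v') | u' v'. u' \<ge> u \<and> v' \<le> v} \<subseteq> - ?S \<or>
        {(u', v') | u' v'. u' \<le> u \<and> v' \<ge> v} \<subseteq> - ?S \<or> {(u', v') | u' v'. u' \<le> u \<and> v' \<le> v} \<subseteq> - ?S \<or>
        {(u', v) | u'. True} \<subseteq> - ?S \<or> {(u, v') | v'. True} \<subseteq> - ?S"
    by (cases "a\<^sub>1 > 0"; cases "a\<^sub>2 > 0") simp_all
qed

lemma bend_binary_constraint:
  assumes "bend B" "\<forall>l\<in>B. lit_vars l \<subseteq> {..<k}" "0 < k"
  shows "\<exists>S i j. quadrant_property S \<and> i < k \<and> j < k \<and> (\<forall>v. (\<exists>l\<in>B. lit_sat v l) \<longleftrightarrow> (v i, v j) \<in> S)"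
proof -
  obtain x y r r\<^sub>1 r\<^sub>2 a\<^sub>1 a\<^sub>2 c d\<^sub>1 d\<^sub>2 where
    r: "r \<in> {LE, LT}" "a\<^sub>1 \<noteq> 0" "a\<^sub>2 \<noteq> 0" "r\<^sub>1 \<in> {LE, LT} \<longleftrightarrow> a\<^sub>1 > 0" "r\<^sub>2 \<in> {LE, LT} \<longleftrightarrow> a\<^sub>2 > 0"
    and B: "B \<subseteq> {Bound x r\<^sub>1 d\<^sub>1, Lin a\<^sub>1 x a\<^sub>2 y r c, Bound y r\<^sub>2 d\<^sub>2}"
    using assms(1) unfolding bend_def full_bend_def by (elim exE conjE) (rule that; simp)
  \<comment> \<open>A variable that occurs only in removed disjuncts may be out of range; index 0
    then replaces it without changing the meaning.\<close>
  define i where "i = (if x < k then x else 0)"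
  define j where "j = (if y < k then y else 0)"
  define S where "S = {(u, v). Bound x r\<^sub>1 d\<^sub>1 \<in> B \<and> cmp_holds r\<^sub>1 u d\<^sub>1 \<or>
    Lin a\<^sub>1 x a\<^sub>2 y r c \<in> B \<and> cmp_holds r (a\<^sub>1 * u + a\<^sub>2 * v) c \<or> Bound y r\<^sub>2 d\<^sub>2 \<in> B \<and> cmp_holds r\<^sub>2 v d\<^sub>2}"
  have "quadrant_property S"
    unfolding S_def by (rule quadrant_property_bend[OF r])
  moreover have "(\<exists>l\<in>B. lit_sat v l) \<longleftrightarrow> (v i, v j) \<in> S" for v
  proof -
    have "(\<exists>l\<in>B. lit_sat v l) \<longleftrightarrow> Bound x r\<^sub>1 d\<^sub>1 \<in> B \<and> lit_sat v (Bound x r\<^sub>1 d\<^sub>1) \<or>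
        Lin a\<^sub>1 x a\<^sub>2 y r c \<in> B \<and> lit_sat v (Lin a\<^sub>1 x a\<^sub>2 y r c) \<or> Bound y r\<^sub>2 d\<^sub>2 \<in> B \<and> lit_sat v (Bound y r\<^sub>2 d\<^sub>2)"
      using B by blast
    moreover have "x < k" if "Bound x r\<^sub>1 d\<^sub>1 \<in> B"
      using bspec[OF assms(2) that] by simp
    moreover have "x < k \<and> y < k" if "Lin a\<^sub>1 x a\<^sub>2 y r c \<in> B"
      using bspec[OF assms(2) that] by simp
    moreover have "y < k" if "Bound y r\<^sub>2 d\<^sub>2 \<in> B"
      using bspec[OF assms(2) that] by simp
    ultimately show ?thesis
      by (auto simp: S_def i_def j_def)
  qed
  moreover have "i < k" "j < k"
    using assms(3) by (simp_all add: i_def j_def)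
  ultimately show ?thesis
    by blast
qed

lemma bijunctive_binary_definable:
  assumes "k \<ge> 1" "bijunctive_definable k R"
  shows "binary_definable quadrant_property k R"
proof -
  obtain F where F: "bijunctive F" "\<forall>B\<in>F. \<forall>l\<in>B. lit_vars l \<subseteq> {..<k}"
    "R = {xs \<in> tuples k. \<forall>B\<in>F. \<exists>l\<in>B. lit_sat ((!) xs) l}"
    using assms(2) unfolding bijunctive_definable_def by blast
  have "\<forall>B\<in>F. \<exists>c. quadrant_property (fst c) \<and> fst (snd c) < k \<and> snd (snd c) < k \<and>
    (\<forall>v. (\<exists>l\<in>B. lit_sat v l) \<longleftrightarrow> (v (fst (snd c)), v (snd (snd c))) \<in> fst c)"
  proof
    fix B
    assume "B \<in> F"
    then obtain S i j where S: "quadrant_property S" "i < k" "j < k" "\<forall>v. (\<exists>l\<in>B. lit_sat v l) \<longleftrightarrow> (v i, v j) \<in> S"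
      using bend_binary_constraint[of B k] F(1,2) assms(1) unfolding bijunctive_def by auto
    show "\<exists>c. quadrant_property (fst c) \<and> fst (snd c) < k \<and> snd (snd c) < k \<and>
      (\<forall>v. (\<exists>l\<in>B. lit_sat v l) \<longleftrightarrow> (v (fst (snd c)), v (snd (snd c))) \<in> fst c)"
      by (rule exI[of _ "(S, i, j)"]) (use S in simp)
  qed
  then obtain C where C: "\<forall>B\<in>F. quadrant_property (fst (C B)) \<and> fst (snd (C B)) < k \<and> snd (snd (C B)) < k \<and>
    (\<forall>v. (\<exists>l\<in>B. lit_sat v l) \<longleftrightarrow> (v (fst (snd (C B))), v (snd (snd (C B)))) \<in> fst (C B))"
    unfolding bchoice_iff by (elim exE)
  show ?thesis
    unfolding binary_definable_def
  proof (intro exI[of _ "C ` F"] conjI)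
    show "finite (C ` F)"
      using F(1) by (simp add: bijunctive_def)
    show "\<forall>(S, i, j)\<in>C ` F. quadrant_property S \<and> i < k \<and> j < k"
      using C by (simp add: case_prod_beta)
    show "R = {xs \<in> tuples k. \<forall>(S, i, j)\<in>C ` F. (xs ! i, xs ! j) \<in> S}"
      unfolding F(3) using C by (simp add: case_prod_beta)
  qed
qed

section \<open>Median closure from the quadrant property\<close>

lemma median_two_le:
  "x \<le> median x y z \<and> y \<le> median x y z \<or> x \<le> median x y z \<and> z \<le> median x y z \<or>
   y \<le> median x y z \<and> z \<le> median x y z"
  by (auto simp: median_max_min max_def min_def)

lemma median_two_ge:
  "median x y z \<le> x \<and> median x y z \<le> y \<or> median x y z \<le> x \<and> median x y z \<le> z \<or>
   median x y z \<le> y \<and> median x y z \<le> z"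
  by (auto simp: median_max_min max_def min_def)

lemma median_cases: "median x y z = x \<or> median x y z = y \<or> median x y z = z"
  by (auto simp: median_max_min max_def min_def)

text \<open>In each coordinate at least two of the three points lie weakly on any given side of the
  median, so by pigeonhole some point lies in each closed quadrant at \<open>(m, n)\<close>. Each
  coordinate of the median is also attained, so the row and the column meet \<open>S\<close> as
  well, and all six alternatives fail.\<close>

lemma quadrant_property_median_closed:
  assumes "quadrant_property S"
  shows "median_closed S"
  unfolding median_closed_def
proof (intro allI impI, rule ccontr)
  fix x y x' y' x'' y''
  assume S: "(x, y) \<in> S" "(x', y') \<in> S" "(x'', y'') \<in> S"
  define m where "m = median x x' x''"
  define n where "n = median y y' y''"
  assume "(median x x' x'', median y y' y'') \<notin> S"
  then have "(m, n) \<in> - S"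
    by (simp add: m_def n_def)
  note mn = assms[unfolded quadrant_property_def, rule_format, OF this]
  have le: "x \<le> m \<and> x' \<le> m \<or> x \<le> m \<and> x'' \<le> m \<or> x' \<le> m \<and> x'' \<le> m"
    "y \<le> n \<and> y' \<le> n \<or> y \<le> n \<and> y'' \<le> n \<or> y' \<le> n \<and> y'' \<le> n"
    unfolding m_def n_def by (rule median_two_le)+
  have ge: "m \<le> x \<and> m \<le> x' \<or> m \<le> x \<and> m \<le> x'' \<or> m \<le> x' \<and> m \<le> x''"
    "n \<le> y \<and> n \<le> y' \<or> n \<le> y \<and> n \<le> y'' \<or> n \<le> y' \<and> n \<le> y''"
    unfolding m_def n_def by (rule median_two_ge)+
  have eq: "m = x \<or> m = x' \<or> m = x''" "n = y \<or> n = y' \<or> n = y''"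
    unfolding m_def n_def by (rule median_cases)+
  from mn show False
  proof (elim disjE)
    assume *: "{(u', v') | u' v'. u' \<ge> m \<and> v' \<ge> n} \<subseteq> - S"
    have "\<exists>(p, q)\<in>S. m \<le> p \<and> n \<le> q"
      using ge S by auto
    then show False using * by auto
  next
    assume *: "{(u', v') | u' v'. u' \<ge> m \<and> v' \<le> n} \<subseteq> - S"
    have "\<exists>(p, q)\<in>S. m \<le> p \<and> q \<le> n"
      using ge(1) le(2) S by auto
    then show False using * by auto
  next
    assume *: "{(u', v') | u' v'. u' \<le> m \<and> v' \<ge> n} \<subseteq> - S"
    have "\<exists>(p, q)\<in>S. p \<le> m \<and> n \<le> q"
      using le(1) ge(2) S by auto
    then show False using * by auto
  next
    assume *: "{(u', v') | u' v'. u' \<le> m \<and> v' \<le> n} \<subseteq> - S"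
    have "\<exists>(p, q)\<in>S. p \<le> m \<and> q \<le> n"
      using le S by auto
    then show False using * by auto
  next
    assume "{(u', n) | u'. True} \<subseteq> - S"
    then show False using eq(2) S by auto
  next
    assume "{(m, v') | v'. True} \<subseteq> - S"
    then show False using eq(1) S by auto
  qed
qed

lemma binary_definable_preserves_median:
  assumes "binary_definable quadrant_property k R"
  shows "preserves median k R"
proof -
  obtain C :: "((rat \<times> rat) set \<times> nat \<times> nat) set" where C: "\<forall>(S, i, j)\<in>C. quadrant_property S \<and> i < k \<and> j < k"
    "R = {xs \<in> tuples k. \<forall>(S, i, j)\<in>C. (xs ! i, xs ! j) \<in> S}"
    using assms unfolding binary_definable_def by blast
  show ?thesis
    unfolding preserves_def
  proof (intro ballI)
    fix x y z
    assume xyz: "x \<in> R" "y \<in> R" "z \<in> R"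
    let ?m = "map (\<lambda>i. median (x ! i) (y ! i) (z ! i)) [0..<k]"
    have "(?m ! i, ?m ! j) \<in> S" if c: "(S, i, j) \<in> C" for S i j
    proof -
      have "quadrant_property S" "i < k" "j < k"
        using C(1) c by auto
      moreover have "(x ! i, x ! j) \<in> S" "(y ! i, y ! j) \<in> S" "(z ! i, z ! j) \<in> S"
        using xyz c unfolding C(2) by auto
      ultimately show ?thesis
        using quadrant_property_median_closed[of S] unfolding median_closed_def by simp
    qed
    then show "?m \<in> R"
      unfolding C(2) by (auto simp: tuples_def)
  qed
qed

theorem theorem3p2:
  fixes k :: nat and R :: "rat list set"
  assumes "k \<ge> 1" and "R \<subseteq> tuples k" and "semilinear k R"
  shows "(preserves median k R \<longleftrightarrow> binary_definable quadrant_property k R) \<and>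
         (binary_definable quadrant_property k R \<longleftrightarrow> bijunctive_definable k R)"
  using preserves_median_bijunctive_definable[OF assms] bijunctive_binary_definable[OF assms(1)]
    binary_definable_preserves_median by blast

end
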